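(* Let $g,h,k>0$, $Q,m\in\mathbb{R}$, let $w\in C^{2,\alpha}_{2\pi}(\mathbb{R})$ be a regular graph solution of the irrotational water-wave equation with conformal mean depth $h$ (as specified in the context), and let $B$, $W$, $\Phi$, $\mathcal{P}$ and $M_{kh}[\,\cdot\,;w]$ be as defined in the context. Then for every $u\in H^1_{2\pi,\circ}(\mathbb{R})$, $$\begin{split}\frac{\delta^2\Lambda}{\delta w^2}(w,h)\big(\mathcal{P}[u],\mathcal{P}[u]\big)={}&2gB\int_0^{2\pi}u\big(\mathcal{C}_{kh}(u')-\Phi u\big)\,dx\\&+2gB\,M_{kh}[u;w]\int_0^{2\pi}\frac{w'}{|W|^2}\big(\mathcal{C}_{kh}(u')-\Phi u\big)\,dx.\end{split}$$
   Context: Notation. $[f]_{2\pi}=\frac1{2\pi}\int_0^{2\pi}f\,dx$. $H^1_{2\pi,\circ}(\mathbb{R})$ is the space of real-valued $2\pi$-periodic $H^1$ functions with zero mean; $C^{2,\alpha}_{2\pi}(\mathbb{R})$ is the space of real $2\pi$-periodic $C^{2,\alpha}$ functions ($0<\alpha<1$). For $D>0$, $\mathcal{C}_D$ is the Fourier multiplier on mean-zero $2\pi$-periodic $L^2$ functions with $\mathcal{C}_D(e^{inx})=-i\coth(nD)e^{inx}$, $n\in\mathbb{Z}\setminus\{0\}$. Regular graph solution. $w\in C^{2,\alpha}_{2\pi}(\mathbb{R})$ has zero mean, $v=w+h$, $\mu=(Q-2gh)/g$, and: (i) $\mu\,\mathcal{C}_{kh}(w')=\frac{w}{k}+w\,\mathcal{C}_{kh}(w')+\mathcal{C}_{kh}(ww')-[w\,\mathcal{C}_{kh}(w')]_{2\pi}$;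 (ii) Bernoulli's law holds pointwise: $\left(\frac{m}{kh}\right)^2=(Q-2gv)\Big((w')^2+\big(\tfrac1k+\mathcal{C}_{kh}(w')\big)^2\Big)$; (iii) (graph condition) $\frac1k+\mathcal{C}_{kh}(w')(x)>0$ for all $x$; (iv) $B:=\frac1g\left(\frac{m}{kh}\right)^2>0$. Second variation. For $q\in H^1_{2\pi,\circ}(\mathbb{R})$, $$\frac{\delta^2\Lambda}{\delta w^2}(w,h)(q,q)=2\int_0^{2\pi}(Q-2gv)\,q\,\mathcal{C}_{kh}(q')-g\Big(\frac1k+\mathcal{C}_{kh}(w')\Big)q^2\,dx,$$ which is the second derivative in $w$, at fixed $h,k,Q,m$, of $\Lambda(w,h)=\int_0^{2\pi}(Qv-gv^2)\big(\frac1k+\mathcal{C}_{kh}(w')\big)+\frac{m^2}{kh}\,dx$. Further definitions. On the real line, $W(x)=\frac1k+\mathcal{C}_{kh}(w')(x)+i\,w'(x)$, and $W'=dW/dx$. The Plotnikov potential is $$\Phi=\operatorname{Im}\Big\{\frac{W'}{W}\Big\}+\frac{|W|^2}{B}\Big(\frac1k+\mathcal{C}_{kh}(w')\Big).$$ For $u\in H^1_{2\pi,\circ}(\mathbb{R})$ the Plotnikov transform is $$\mathcal{P}[u]=u\Big(\frac1k+\mathcal{C}_{kh}(w')\Big)+w'\,\mathcal{C}_{kh}(u),$$ which again belongs to $H^1_{2\pi,\circ}(\mathbb{R})$, and $$M_{kh}[u;w]=\big[\mathcal{C}_{kh}(u)\,\mathcal{C}_{kh}(w')-u\,w'\big]_{2\pi}.$$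 *)

theory Defs
  imports "HOL-Analysis.Analysis"
begin

section \<open>Periodic function spaces\<close>

text \<open>Functions on the circle are represented by \<open>2\<pi>\<close>-periodic functions on the whole line.
  Elements of \<open>L2_per\<close> are functions, not classes modulo null sets.\<close>

definition periodic2pi :: "(real \<Rightarrow> real) \<Rightarrow> bool" where
  "periodic2pi f \<longleftrightarrow> (\<forall>x. f (x + 2 * pi) = f x)"

definition int2pi :: "(real \<Rightarrow> real) \<Rightarrow> real" where
  "int2pi f = (LINT x:{0..2 * pi}|lborel. f x)"

definition mean2pi :: "(real \<Rightarrow> real) \<Rightarrow> real" where
  "mean2pi f = 1 / (2 * pi) * int2pi f"

definition L2_per :: "(real \<Rightarrow> real) set" where
  "L2_per = {f. periodic2pi f \<and> f \<in> borel_measurable lborel \<and>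
                set_integrable lborel {0..2 * pi} (\<lambda>x. (f x)\<^sup>2)}"

text \<open>\<open>f\<close> is the (absolutely) continuous representative of an \<open>H\<^sup>1\<close> function with weak derivative \<open>v\<close>.\<close>

definition has_weak_deriv :: "(real \<Rightarrow> real) \<Rightarrow> (real \<Rightarrow> real) \<Rightarrow> bool" where
  "has_weak_deriv f v \<longleftrightarrow>
     v \<in> L2_per \<and> (\<forall>a b. a \<le> b \<longrightarrow> f b - f a = (LINT t:{a..b}|lborel. v t))"

definition H1_per0 :: "(real \<Rightarrow> real) set" where
  "H1_per0 = {f. periodic2pi f \<and> (\<exists>v. has_weak_deriv f v) \<and> mean2pi f = 0}"

text \<open>A representative of the weak derivative, which is unique up to null sets.\<close>

definition weak_deriv :: "(real \<Rightarrow> real) \<Rightarrow> real \<Rightarrow> real" where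
  "weak_deriv f = (SOME v. has_weak_deriv f v)"

definition C2_Hoelder_per :: "real \<Rightarrow> (real \<Rightarrow> real) set" where
  "C2_Hoelder_per \<alpha> = {f. periodic2pi f \<and>
     (\<forall>x. f differentiable (at x)) \<and> (\<forall>x. deriv f differentiable (at x)) \<and>
     (\<exists>K. \<forall>x y. \<bar>deriv (deriv f) x - deriv (deriv f) y\<bar> \<le> K * \<bar>x - y\<bar> powr \<alpha>)}"

section \<open>The conjugation operator of a strip of depth \<open>D\<close>\<close>

definition coth :: "real \<Rightarrow> real" where
  "coth x = cosh x / sinh x"

definition fourier_coeff :: "(real \<Rightarrow> real) \<Rightarrow> int \<Rightarrow> complex" where
  "fourier_coeff f n =
     1 / (2 * pi) * (LINT x:{0..2 * pi}|lborel. of_real (f x) * exp (- \<i> * of_int n * of_real x))"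

definition is_conjugate :: "real \<Rightarrow> (real \<Rightarrow> real) \<Rightarrow> (real \<Rightarrow> real) \<Rightarrow> bool" where
  "is_conjugate D f \<phi> \<longleftrightarrow> \<phi> \<in> L2_per \<and> fourier_coeff \<phi> 0 = 0 \<and>
     (\<forall>n. n \<noteq> 0 \<longrightarrow> fourier_coeff \<phi> n = - \<i> * of_real (coth (of_int n * D)) * fourier_coeff f n)"

text \<open>The operator is applied to real mean-zero \<open>f\<close> in \<open>L2_per\<close> only; the multiplier is
  conjugate-symmetric, so the image is again real. The Fourier coefficients fix the image up to
  null sets; whenever it has a continuous representative, this (unique) representative is taken,
  so that pointwise statements about the image are meaningful.\<close>

definition conj_op :: "real \<Rightarrow> (real \<Rightarrow> real) \<Rightarrow> real \<Rightarrow> real" where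
  "conj_op D f = (SOME \<phi>. is_conjugate D f \<phi> \<and>
     ((\<exists>\<psi>. is_conjugate D f \<psi> \<and> continuous_on UNIV \<psi>) \<longrightarrow> continuous_on UNIV \<phi>))"

section \<open>The water-wave equation and its variational structure\<close>

definition bernoulli_B :: "real \<Rightarrow> real \<Rightarrow> real \<Rightarrow> real \<Rightarrow> real" where
  "bernoulli_B g h k m = 1 / g * (m / (k * h))\<^sup>2"

definition regular_graph_solution ::
  "real \<Rightarrow> real \<Rightarrow> real \<Rightarrow> real \<Rightarrow> real \<Rightarrow> real \<Rightarrow> (real \<Rightarrow> real) \<Rightarrow> bool" where
  "regular_graph_solution \<alpha> g h k Q m w \<longleftrightarrow>
     w \<in> C2_Hoelder_per \<alpha> \<and> mean2pi w = 0 \<and>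
     (\<forall>x. (Q - 2 * g * h) / g * conj_op (k * h) (deriv w) x =
        w x / k + w x * conj_op (k * h) (deriv w) x
        + conj_op (k * h) (\<lambda>y. w y * deriv w y) x
        - mean2pi (\<lambda>y. w y * conj_op (k * h) (deriv w) y)) \<and>
     (\<forall>x. (m / (k * h))\<^sup>2 =
        (Q - 2 * g * (w x + h)) * ((deriv w x)\<^sup>2 + (1 / k + conj_op (k * h) (deriv w) x)\<^sup>2)) \<and>
     (\<forall>x. 1 / k + conj_op (k * h) (deriv w) x > 0) \<and>
     bernoulli_B g h k m > 0"

text \<open>\<open>Lam\<close> is considered on all of \<open>H1_per0\<close>, hence the weak derivative; since \<open>conj_op\<close>
  depends on its argument through Fourier coefficients only, \<open>deriv w\<close> gives the same value when
  \<open>w\<close> is continuously differentiable.\<close>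

definition Lam :: "real \<Rightarrow> real \<Rightarrow> real \<Rightarrow> real \<Rightarrow> (real \<Rightarrow> real) \<Rightarrow> real \<Rightarrow> real" where
  "Lam g k Q m w h = int2pi (\<lambda>x.
     (Q * (w x + h) - g * (w x + h)\<^sup>2) * (1 / k + conj_op (k * h) (weak_deriv w) x)
     + m\<^sup>2 / (k * h))"

text \<open>The second derivative in \<open>w\<close> as a bilinear form (iterated directional derivative).\<close>

definition second_variation ::
  "real \<Rightarrow> real \<Rightarrow> real \<Rightarrow> real \<Rightarrow> (real \<Rightarrow> real) \<Rightarrow> real \<Rightarrow> (real \<Rightarrow> real) \<Rightarrow> (real \<Rightarrow> real) \<Rightarrow> real" where
  "second_variation g k Q m w h q\<^sub>1 q\<^sub>2 =
     deriv (\<lambda>s. deriv (\<lambda>t. Lam g k Q m (\<lambda>x. w x + s * q\<^sub>1 x + t * q\<^sub>2 x) h) 0) 0"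

section \<open>Plotnikov's potential and transform\<close>

definition W_fun :: "real \<Rightarrow> real \<Rightarrow> (real \<Rightarrow> real) \<Rightarrow> real \<Rightarrow> complex" where
  "W_fun h k w x = Complex (1 / k + conj_op (k * h) (deriv w) x) (deriv w x)"

definition plotnikov_potential ::
  "real \<Rightarrow> real \<Rightarrow> real \<Rightarrow> real \<Rightarrow> (real \<Rightarrow> real) \<Rightarrow> real \<Rightarrow> real" where
  "plotnikov_potential g h k m w x =
     Im (vector_derivative (W_fun h k w) (at x) / W_fun h k w x)
     + (cmod (W_fun h k w x))\<^sup>2 / bernoulli_B g h k m * (1 / k + conj_op (k * h) (deriv w) x)"

definition plotnikov_transform ::
  "real \<Rightarrow> real \<Rightarrow> (real \<Rightarrow> real) \<Rightarrow> (real \<Rightarrow> real) \<Rightarrow> real \<Rightarrow> real" where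
  "plotnikov_transform h k w u x =
     u x * (1 / k + conj_op (k * h) (deriv w) x) + deriv w x * conj_op (k * h) u x"

definition M_mean :: "real \<Rightarrow> (real \<Rightarrow> real) \<Rightarrow> (real \<Rightarrow> real) \<Rightarrow> real" where
  "M_mean D u w = mean2pi (\<lambda>x. conj_op D u x * conj_op D (deriv w) x - u x * deriv w x)"

end

theory Submission
  imports Defs
begin

text \<open>
  Write \<open>W = a + i b\<close>, \<open>U = C u + i u\<close>, \<open>V = W U\<close>, so that \<open>q = Im V\<close> is the Plotnikov transform of
  \<open>u\<close>. All of these are boundary traces of holomorphic functions on a strip which are real on the
  bottom; such traces form an algebra, and their imaginary parts have mean zero. Hence the conjugate
  of \<open>q'\<close> is \<open>Re V'\<close>. With \<open>F = V - M\<close> and \<open>R = Re F\<close>, Bernoulli's law turns the difference of the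
  integrands of the two sides into \<open>Im (F F' / W\<^sup>2)\<close> plus the derivative of \<open>R q / |W|\<^sup>2\<close>, up to
  constant factors.
  The water-wave equation says precisely that \<open>1 / W\<close> is again such a trace, so that both terms
  integrate to zero.
\<close>

section \<open>Square-integrable functions\<close>

text \<open>No holomorphic function is ever constructed: being a trace is a symmetry of Fourier
  coefficients. This calls for Fourier analysis of L2 functions on the circle, above all uniqueness
  of coefficients, because \<open>conj_op\<close> is specified by coefficients while the water-wave
  equation and Bernoulli's law are pointwise. The obstacle is regularity. For \<open>u\<close> in H1
  the derivative \<open>u'\<close> and its conjugate are merely square integrable; hence product
  rules are integrated ones, and in each product of traces at most one factor fails to be
  continuous. In contrast, \<open>W\<close> has to be continuously differentiable so that \<Phi> is
  continuous. For the imaginary part this is given; for \<open>a\<close> it is read off from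
  Bernoulli's law, an equation for \<open>a^2\<close>, and not from mapping properties of the
  conjugation on Hoelder spaces. The constant \<open>M\<close> is the mean of \<open>Re V\<close>,
  since \<open>C u\<close> has mean zero; with it \<open>R\<close> is the conjugate of
  \<open>q\<close>.\<close>

definition sq_integrable :: "'a measure \<Rightarrow> ('a \<Rightarrow> 'b::{banach, second_countable_topology}) \<Rightarrow> bool" where
  "sq_integrable M f \<longleftrightarrow> f \<in> borel_measurable M \<and> integrable M (\<lambda>x. (norm (f x))\<^sup>2)"

lemma sq_integrable_measurable [measurable_dest]:
  "sq_integrable M f \<Longrightarrow> f \<in> borel_measurable M"
  by (simp add: sq_integrable_def)

lemma sq_integrableD: "sq_integrable M f \<Longrightarrow> integrable M (\<lambda>x. (norm (f x))\<^sup>2)"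
  by (simp add: sq_integrable_def)

text \<open>Young's inequality with a free weight, standing in for Cauchy-Schwarz: a small
  \<open>d\<close> makes the second term small, and a still smaller integral of the first square
  absorbs the factor \<open>1 / d\<close>. The constant is not sharp.\<close>

lemma mult_le_weighted_squares:
  fixes a b d :: real
  assumes "d > 0"
  shows "a * b \<le> a\<^sup>2 / d + d * b\<^sup>2"
proof -
  have "0 \<le> (a - d * b)\<^sup>2 + a\<^sup>2 + (d * b)\<^sup>2" by simp
  also have "\<dots> = 2 * (d * (a\<^sup>2 / d + d * b\<^sup>2 - a * b))"
    using assms by (simp add: power2_eq_square field_simps)
  finally show ?thesis using assms by (simp add: zero_le_mult_iff)
qed

lemma sq_integrable_bound:
  fixes f :: "'a \<Rightarrow> 'b::{banach, second_countable_topology}"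
    and g :: "'a \<Rightarrow> 'c::{banach, second_countable_topology}"
  assumes "sq_integrable M g" and [measurable]: "f \<in> borel_measurable M"
    and le: "AE x in M. norm (f x) \<le> C * norm (g x)"
  shows "sq_integrable M f"
  unfolding sq_integrable_def
proof
  show "integrable M (\<lambda>x. (norm (f x))\<^sup>2)"
  proof (rule Bochner_Integration.integrable_bound)
    show "integrable M (\<lambda>x. C\<^sup>2 * (norm (g x))\<^sup>2)"
      using sq_integrableD[OF assms(1)] by simp
    show "AE x in M. norm ((norm (f x))\<^sup>2) \<le> norm (C\<^sup>2 * (norm (g x))\<^sup>2)"
      using le
    proof eventually_elim
      case (elim x)
      have "(norm (f x))\<^sup>2 \<le> (C * norm (g x))\<^sup>2" using elim by (intro power_mono) auto
      then show ?case by (simp add: power_mult_distrib)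
    qed
  qed auto
qed fact

lemma sq_integrable_add:
  assumes "sq_integrable M f" "sq_integrable M g"
  shows "sq_integrable M (\<lambda>x. f x + g x)"
  unfolding sq_integrable_def
proof
  note [measurable] = sq_integrable_measurable[OF assms(1)] sq_integrable_measurable[OF assms(2)]
  show "(\<lambda>x. f x + g x) \<in> borel_measurable M" by measurable
  show "integrable M (\<lambda>x. (norm (f x + g x))\<^sup>2)"
  proof (rule Bochner_Integration.integrable_bound)
    show "integrable M (\<lambda>x. 2 * (norm (f x))\<^sup>2 + 2 * (norm (g x))\<^sup>2)"
      using sq_integrableD[OF assms(1)] sq_integrableD[OF assms(2)] by simp
    show "AE x in M. norm ((norm (f x + g x))\<^sup>2) \<le> norm (2 * (norm (f x))\<^sup>2 + 2 * (norm (g x))\<^sup>2)"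
    proof (rule AE_I2)
      fix x
      have "(norm (f x + g x))\<^sup>2 \<le> (norm (f x) + norm (g x))\<^sup>2"
        by (intro power_mono norm_triangle_ineq) auto
      also have "\<dots> \<le> 2 * (norm (f x))\<^sup>2 + 2 * (norm (g x))\<^sup>2"
        using zero_le_power2[of "norm (f x) - norm (g x)"]
        by (simp add: power2_eq_square algebra_simps)
      finally show "norm ((norm (f x + g x))\<^sup>2) \<le> norm (2 * (norm (f x))\<^sup>2 + 2 * (norm (g x))\<^sup>2)"
        by simp
    qed
  qed auto
qed

lemma sq_integrable_minus: "sq_integrable M f \<Longrightarrow> sq_integrable M (\<lambda>x. - f x)"
  by (simp add: sq_integrable_def)

lemma sq_integrable_diff:
  assumes "sq_integrable M f" "sq_integrable M g"
  shows "sq_integrable M (\<lambda>x. f x - g x)"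
  using sq_integrable_add[OF assms(1) sq_integrable_minus[OF assms(2)]] by simp

lemma integrable_mult_sq_integrable:
  fixes f g :: "'a \<Rightarrow> 'b::{banach, second_countable_topology, real_normed_algebra}"
  assumes "sq_integrable M f" "sq_integrable M g"
  shows "integrable M (\<lambda>x. f x * g x)"
proof (rule Bochner_Integration.integrable_bound)
  note [measurable] = sq_integrable_measurable[OF assms(1)] sq_integrable_measurable[OF assms(2)]
  show "integrable M (\<lambda>x. (norm (f x))\<^sup>2 + (norm (g x))\<^sup>2)"
    using sq_integrableD[OF assms(1)] sq_integrableD[OF assms(2)] by simp
  show "AE x in M. norm (f x * g x) \<le> norm ((norm (f x))\<^sup>2 + (norm (g x))\<^sup>2)"
  proof (rule AE_I2)
    fix x
    have "norm (f x * g x) \<le> norm (f x) * norm (g x)" by (rule norm_mult_ineq)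
    also have "\<dots> \<le> (norm (f x))\<^sup>2 + (norm (g x))\<^sup>2"
      using mult_le_weighted_squares[of 1 "norm (f x)" "norm (g x)"] by simp
    finally show "norm (f x * g x) \<le> norm ((norm (f x))\<^sup>2 + (norm (g x))\<^sup>2)" by simp
  qed
  show "(\<lambda>x. f x * g x) \<in> borel_measurable M" by measurable
qed

section \<open>Completeness of L2 over a finite measure\<close>

context finite_measure begin

lemma sq_integrable_bounded:
  fixes f :: "'a \<Rightarrow> 'b::{banach, second_countable_topology}"
  assumes "f \<in> borel_measurable M" "\<And>x. x \<in> space M \<Longrightarrow> norm (f x) \<le> K"
  shows "sq_integrable M f"
proof (rule sq_integrable_bound)
  show "sq_integrable M (\<lambda>x. 1 :: real)" by (simp add: sq_integrable_def)
  show "AE x in M. norm (f x) \<le> K * norm (1 :: real)" using assms(2) by auto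
qed fact

lemma sq_integrable_imp_integrable:
  fixes f :: "'a \<Rightarrow> 'b::{banach, second_countable_topology}"
  assumes "sq_integrable M f"
  shows "integrable M f"
proof (rule Bochner_Integration.integrable_bound)
  note [measurable] = sq_integrable_measurable[OF assms(1)]
  show "f \<in> borel_measurable M" by measurable
  show "integrable M (\<lambda>x. (norm (f x))\<^sup>2 + 1)" using sq_integrableD[OF assms] by simp
  show "AE x in M. norm (f x) \<le> norm ((norm (f x))\<^sup>2 + 1)"
  proof (rule AE_I2)
    fix x show "norm (f x) \<le> norm ((norm (f x))\<^sup>2 + 1)"
      using mult_le_weighted_squares[of 1 "norm (f x)" 1] by simp
  qed
qed

text \<open>Over a finite measure, L2-Cauchy implies L1-Cauchy, which yields a subsequence
  converging almost everywhere; Fatou's lemma along it bounds the L2 distance to the pointwise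
  limit.\<close>

lemma L2_complete:
  fixes s :: "nat \<Rightarrow> 'a \<Rightarrow> 'b::{banach, second_countable_topology}"
  assumes s: "\<And>n. sq_integrable M (s n)"
    and cauchy: "\<And>e. e > 0 \<Longrightarrow> \<exists>N. \<forall>i\<ge>N. \<forall>j\<ge>N. (LINT x|M. (norm (s i x - s j x))\<^sup>2) < e"
  obtains f where "sq_integrable M f" "(\<lambda>n. LINT x|M. (norm (s n x - f x))\<^sup>2) \<longlonglongrightarrow> 0"
proof -
  note [measurable] = sq_integrable_measurable[OF s]
  have sd: "sq_integrable M (\<lambda>x. s i x - s j x)" for i j by (intro sq_integrable_diff s)
  have "\<exists>N. \<forall>i\<ge>N. \<forall>j\<ge>N. (LINT x|M. norm (s i x - s j x)) < e" if e: "e > 0" for e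
  proof -
    \<comment> \<open>The summand 1 keeps the denominator positive for a space of measure
      zero.\<close>
    define d where "d = e / 2 / (measure M (space M) + 1)"
    have m0: "measure M (space M) \<ge> 0" by simp
    have m1: "measure M (space M) + 1 > 0" using m0 by linarith
    have d: "d > 0" using e m1 by (simp add: d_def)
    have dm: "d * (measure M (space M) + 1) = e / 2"
      unfolding d_def using m1 by (intro nonzero_eq_divide_eq[THEN iffD1] refl) auto
    obtain N where N: "\<And>i j. i \<ge> N \<Longrightarrow> j \<ge> N \<Longrightarrow> (LINT x|M. (norm (s i x - s j x))\<^sup>2) < d * (e / 2)"
      using cauchy[of "d * (e/2)"] d e by auto
    have "(LINT x|M. norm (s i x - s j x)) < e" if ij: "i \<ge> N" "j \<ge> N" for i j
    proof -
      have "(LINT x|M. norm (s i x - s j x)) \<le> (LINT x|M. (norm (s i x - s j x))\<^sup>2 / d + d)"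
      proof (rule integral_mono)
        show "integrable M (\<lambda>x. norm (s i x - s j x))"
          using sq_integrable_imp_integrable[OF sd] by simp
        show "integrable M (\<lambda>x. (norm (s i x - s j x))\<^sup>2 / d + d)"
          using sq_integrableD[OF sd] by simp
        show "norm (s i x - s j x) \<le> (norm (s i x - s j x))\<^sup>2 / d + d" for x
          using mult_le_weighted_squares[OF d, of "norm (s i x - s j x)" 1] by simp
      qed
      also have "\<dots> = (LINT x|M. (norm (s i x - s j x))\<^sup>2) / d + d * measure M (space M)"
        using sq_integrableD[OF sd, of i j] by simp
      also have "\<dots> < e / 2 + e / 2"
      proof (rule add_less_le_mono)
        show "(LINT x|M. (norm (s i x - s j x))\<^sup>2) / d < e / 2"
          using N[OF ij] d by (simp add: field_simps)
        show "d * measure M (space M) \<le> e / 2"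
          using dm d by (simp add: distrib_left)
      qed
      finally show ?thesis by simp
    qed
    then show ?thesis by auto
  qed
  then obtain r where r: "strict_mono r" "AE x in M. Cauchy (\<lambda>i. s (r i) x)"
    using cauchy_L1_AE_cauchy_subseq[of M s] sq_integrable_imp_integrable[OF s] by metis
  define f where "f x = lim (\<lambda>i. s (r i) x)" for x
  have [measurable]: "f \<in> borel_measurable M" unfolding f_def by measurable
  have lim: "AE x in M. (\<lambda>i. s (r i) x) \<longlonglongrightarrow> f x"
    using r(2) by eventually_elim (simp add: f_def Cauchy_convergent_iff convergent_LIMSEQ_iff)
  \<comment> \<open>Extended nonnegative integrals are used because integrability of the squared
    distance is only a consequence of this bound.\<close>
  have key: "\<exists>N. \<forall>n\<ge>N. (\<integral>\<^sup>+x. ennreal ((norm (s n x - f x))\<^sup>2) \<partial>M) \<le> ennreal e" if e: "e > 0" for e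
  proof -
    obtain N where N: "\<And>i j. i \<ge> N \<Longrightarrow> j \<ge> N \<Longrightarrow> (LINT x|M. (norm (s i x - s j x))\<^sup>2) < e"
      using cauchy[OF e] by auto
    have "(\<integral>\<^sup>+x. ennreal ((norm (s n x - f x))\<^sup>2) \<partial>M) \<le> ennreal e" if n: "n \<ge> N" for n
    proof -
      have "(\<integral>\<^sup>+x. ennreal ((norm (s n x - f x))\<^sup>2) \<partial>M)
          = (\<integral>\<^sup>+x. liminf (\<lambda>i. ennreal ((norm (s n x - s (r i) x))\<^sup>2)) \<partial>M)"
      proof (rule nn_integral_cong_AE, use lim in eventually_elim)
        case (elim x)
        have "(\<lambda>i. ennreal ((norm (s n x - s (r i) x))\<^sup>2)) \<longlonglongrightarrow> ennreal ((norm (s n x - f x))\<^sup>2)"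
          by (intro tendsto_intros tendsto_ennrealI elim)
        then show ?case by (rule lim_imp_Liminf[OF trivial_limit_sequentially, symmetric])
      qed
      also have "\<dots> \<le> liminf (\<lambda>i. \<integral>\<^sup>+x. ennreal ((norm (s n x - s (r i) x))\<^sup>2) \<partial>M)"
        by (rule nn_integral_liminf) measurable
      also have "\<dots> \<le> liminf (\<lambda>i. ennreal e)"
      proof (rule Liminf_mono, rule eventually_sequentiallyI[of N])
        fix i assume i: "N \<le> i"
        have "r i \<ge> N" using seq_suble[OF r(1), of i] i by linarith
        then have "(LINT x|M. (norm (s n x - s (r i) x))\<^sup>2) \<le> e" using N[OF n] by fastforce
        moreover have "(\<integral>\<^sup>+x. ennreal ((norm (s n x - s (r i) x))\<^sup>2) \<partial>M)
            = ennreal (LINT x|M. (norm (s n x - s (r i) x))\<^sup>2)"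
          by (intro nn_integral_eq_integral sq_integrableD[OF sd]) auto
        ultimately show "(\<integral>\<^sup>+x. ennreal ((norm (s n x - s (r i) x))\<^sup>2) \<partial>M) \<le> ennreal e"
          using e by (simp add: ennreal_leI)
      qed
      also have "\<dots> = ennreal e" by (simp add: Liminf_const)
      finally show ?thesis .
    qed
    then show ?thesis by auto
  qed
  have int: "integrable M (\<lambda>x. (norm (s n x - f x))\<^sup>2)"
    if "(\<integral>\<^sup>+x. ennreal ((norm (s n x - f x))\<^sup>2) \<partial>M) \<le> ennreal e" for n e
    using that by (intro integrableI_bounded) (auto intro: le_less_trans)
  obtain N1 where N1: "(\<integral>\<^sup>+x. ennreal ((norm (s N1 x - f x))\<^sup>2) \<partial>M) \<le> ennreal 1"
    using key[of 1] by auto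
  \<comment> \<open>One index at finite distance suffices: \<open>f\<close> is \<open>s N1\<close>
    minus this difference.\<close>
  have "sq_integrable M (\<lambda>x. s N1 x - f x)"
    using int[OF N1] by (simp add: sq_integrable_def)
  from sq_integrable_diff[OF s[of N1] this] have f: "sq_integrable M f" by simp
  moreover have "(\<lambda>n. LINT x|M. (norm (s n x - f x))\<^sup>2) \<longlonglongrightarrow> 0"
  proof (rule LIMSEQ_I)
    fix e :: real assume e: "e > 0"
    obtain N where N: "\<And>n. n \<ge> N \<Longrightarrow> (\<integral>\<^sup>+x. ennreal ((norm (s n x - f x))\<^sup>2) \<partial>M) \<le> ennreal (e/2)"
      using key[of "e/2"] e by auto
    have "norm ((LINT x|M. (norm (s n x - f x))\<^sup>2) - 0) < e" if "n \<ge> N" for n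
    proof -
      have "ennreal (LINT x|M. (norm (s n x - f x))\<^sup>2) \<le> ennreal (e/2)"
        using N[OF that] nn_integral_eq_integral[OF int[OF N[OF that]]] by simp
      then have "(LINT x|M. (norm (s n x - f x))\<^sup>2) \<le> e/2"
        using e by (subst (asm) ennreal_le_iff) auto
      moreover have "(LINT x|M. (norm (s n x - f x))\<^sup>2) \<ge> 0" by simp
      ultimately show ?thesis using e by simp
    qed
    then show "\<exists>no. \<forall>n\<ge>no. norm ((LINT x|M. (norm (s n x - f x))\<^sup>2) - 0) < e" by auto
  qed
  ultimately show thesis by (rule that)
qed

end

text \<open>Weak convergence against a fixed \<open>g\<close>; this is what carries Fourier
  coefficients, also those of products, over to L2 limits.\<close>

lemma L2_tendsto_integral_mult:
  fixes f g :: "'a \<Rightarrow> 'b::{banach, second_countable_topology, real_normed_algebra}"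
  assumes s: "\<And>n. sq_integrable M (s n)" and f: "sq_integrable M f" and g: "sq_integrable M g"
    and lim: "(\<lambda>n. LINT x|M. (norm (s n x - f x))\<^sup>2) \<longlonglongrightarrow> 0"
  shows "(\<lambda>n. LINT x|M. s n x * g x) \<longlonglongrightarrow> (LINT x|M. f x * g x)"
proof (rule LIMSEQ_I)
  fix e :: real assume e: "e > 0"
  define C where "C = (LINT x|M. (norm (g x))\<^sup>2)"
  have C: "C \<ge> 0" by (simp add: C_def)
  define d where "d = e / 2 / (C + 1)"
  have d: "d > 0" using e C by (simp add: d_def)
  have dC: "d * (C + 1) = e / 2" unfolding d_def using C by (intro nonzero_eq_divide_eq[THEN iffD1] refl) auto
  obtain N where N: "\<And>n. n \<ge> N \<Longrightarrow> (LINT x|M. (norm (s n x - f x))\<^sup>2) < d * (e/2)"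
    using LIMSEQ_D[OF lim, of "d * (e/2)"] d e by auto
  have "norm ((LINT x|M. s n x * g x) - (LINT x|M. f x * g x)) < e" if n: "n \<ge> N" for n
  proof -
    have sf: "sq_integrable M (\<lambda>x. s n x - f x)" by (intro sq_integrable_diff s f)
    have "(LINT x|M. s n x * g x) - (LINT x|M. f x * g x) = (LINT x|M. (s n x - f x) * g x)"
      by (simp add: left_diff_distrib integrable_mult_sq_integrable s f g)
    also have "norm \<dots> \<le> (LINT x|M. norm ((s n x - f x) * g x))"
      by simp
    also have "\<dots> \<le> (LINT x|M. (norm (s n x - f x))\<^sup>2 / d + d * (norm (g x))\<^sup>2)"
    proof (rule integral_mono)
      show "integrable M (\<lambda>x. norm ((s n x - f x) * g x))"
        using integrable_mult_sq_integrable[OF sf g] by simp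
      show "integrable M (\<lambda>x. (norm (s n x - f x))\<^sup>2 / d + d * (norm (g x))\<^sup>2)"
        using sq_integrableD[OF sf] sq_integrableD[OF g] by simp
      show "norm ((s n x - f x) * g x) \<le> (norm (s n x - f x))\<^sup>2 / d + d * (norm (g x))\<^sup>2" for x
        using norm_mult_ineq[of "s n x - f x" "g x"]
          mult_le_weighted_squares[OF d, of "norm (s n x - f x)" "norm (g x)"] by linarith
    qed
    also have "\<dots> = (LINT x|M. (norm (s n x - f x))\<^sup>2) / d + d * C"
      using sq_integrableD[OF sf] sq_integrableD[OF g] by (simp add: C_def)
    also have "\<dots> < e / 2 + e / 2"
    proof (rule add_less_le_mono)
      show "(LINT x|M. (norm (s n x - f x))\<^sup>2) / d < e / 2"
        using N[OF n] d by (simp add: field_simps)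
      show "d * C \<le> e / 2"
        using dC d by (simp add: distrib_left)
    qed
    finally show ?thesis by simp
  qed
  then show "\<exists>no. \<forall>n\<ge>no. norm ((LINT x|M. s n x * g x) - (LINT x|M. f x * g x)) < e" by auto
qed

section \<open>Fourier coefficients on the circle\<close>

text \<open>A closed interval instead of a quotient, in agreement with \<open>int2pi\<close>. Both
  endpoints stand for the same point of the circle; one of them is discarded as a null set where
  this matters.\<close>

abbreviation circ :: "real measure" where
  "circ \<equiv> restrict_space lborel {0..2 * pi}"

lemma finite_measure_circ: "finite_measure circ"
  by (rule finite_measureI) (simp add: emeasure_restrict_space space_restrict_space)

interpretation circ: finite_measure circ
  by (rule finite_measure_circ)

lemma space_circ [simp]: "space circ = {0..2 * pi}"
  by (simp add: space_restrict_space)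

lemma measure_circ [simp]: "measure circ {0..2 * pi} = 2 * pi"
  by (simp add: measure_restrict_space)

lemma set_integral_circ:
  fixes f :: "real \<Rightarrow> 'b::{banach, second_countable_topology}"
  shows "(LINT x:{0..2 * pi}|lborel. f x) = (LINT x|circ. f x)"
  by (simp add: set_lebesgue_integral_def integral_restrict_space)

lemma set_integrable_circ:
  fixes f :: "real \<Rightarrow> 'b::{banach, second_countable_topology}"
  shows "set_integrable lborel {0..2 * pi} f \<longleftrightarrow> integrable circ f"
  by (simp add: set_integrable_def integrable_restrict_space)

lemma borel_measurable_circ: "f \<in> borel_measurable borel \<Longrightarrow> f \<in> borel_measurable circ"
  by (intro measurable_restrict_space1) simp

lemma borel_measurable_circ_continuous:
  fixes f :: "real \<Rightarrow> 'b::topological_space"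
  assumes "continuous_on {0..2 * pi} f"
  shows "f \<in> borel_measurable circ"
proof -
  have "f \<in> borel_measurable (restrict_space borel {0..2 * pi})"
    by (rule borel_measurable_continuous_on_restrict[OF assms])
  then show ?thesis
    by (subst measurable_cong_sets[where M'="restrict_space borel {0..2 * pi}" and N'=borel])
       (auto simp: sets_restrict_space)
qed

lemma sq_integrable_circ_continuous:
  fixes f :: "real \<Rightarrow> 'b::{banach, second_countable_topology}"
  assumes "continuous_on {0..2 * pi} f"
  shows "sq_integrable circ f"
proof -
  have "compact (f ` {0..2 * pi})"
    using assms by (intro compact_continuous_image) auto
  then obtain K where "\<And>x. x \<in> {0..2 * pi} \<Longrightarrow> norm (f x) \<le> K"
    using compact_imp_bounded bounded_iff by (metis imageI)
  then show ?thesis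
    using assms by (intro circ.sq_integrable_bounded[of f K] borel_measurable_circ_continuous) auto
qed

lemma integrable_circ_continuous:
  fixes f :: "real \<Rightarrow> 'b::{banach, second_countable_topology}"
  assumes "continuous_on {0..2 * pi} f"
  shows "integrable circ f"
  by (intro circ.sq_integrable_imp_integrable sq_integrable_circ_continuous assms)

lemma integrable_circ_mult_continuous:
  fixes f :: "real \<Rightarrow> complex"
  assumes "integrable circ f" "continuous_on {0..2 * pi} g"
  shows "integrable circ (\<lambda>x. f x * g x)"
proof -
  have "compact (g ` {0..2 * pi})"
    using assms by (intro compact_continuous_image) auto
  then obtain K where K: "\<And>x. x \<in> {0..2 * pi} \<Longrightarrow> norm (g x) \<le> K"
    using compact_imp_bounded bounded_iff by (metis imageI)
  have [measurable]: "g \<in> borel_measurable circ"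
    by (intro borel_measurable_circ_continuous assms)
  show ?thesis
  proof (rule Bochner_Integration.integrable_bound)
    show "integrable circ (\<lambda>x. K * norm (f x))" using assms(1) by simp
    show "(\<lambda>x. f x * g x) \<in> borel_measurable circ"
      using assms(1) by (intro borel_measurable_times) auto
    show "AE x in circ. norm (f x * g x) \<le> norm (K * norm (f x))"
    proof (rule AE_I2)
      fix x assume "x \<in> space circ"
      then have "norm (g x) * norm (f x) \<le> \<bar>K\<bar> * norm (f x)"
        using K[of x] by (intro mult_right_mono) auto
      then show "norm (f x * g x) \<le> norm (K * norm (f x))"
        by (simp add: norm_mult abs_mult mult.commute)
    qed
  qed
qed

text \<open>Complex values are needed because a trace combines a real function with its conjugate;
  \<open>fourier_coeff\<close> covers real functions only.\<close>

definition fc :: "(real \<Rightarrow> complex) \<Rightarrow> int \<Rightarrow> complex" where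
  "fc F n = 1 / (2 * pi) * (LINT x|circ. F x * cis (- (of_int n * x)))"

lemma fourier_coeff_eq_fc: "fourier_coeff f n = fc (\<lambda>x. of_real (f x)) n"
  by (simp add: fourier_coeff_def fc_def set_integral_circ cis_conv_exp mult.assoc)

lemma continuous_on_cis_linear: "continuous_on A (\<lambda>x. cis (a * x))"
  by (intro continuous_intros)

lemma continuous_on_cis_linear': "continuous_on A (\<lambda>x. cis (- (a * x)))"
  by (intro continuous_intros)

lemma integrable_mult_cis:
  "integrable circ F \<Longrightarrow> integrable circ (\<lambda>x. F x * cis (a * x))"
  by (intro integrable_circ_mult_continuous continuous_on_cis_linear)

lemma integrable_mult_cis':
  "integrable circ F \<Longrightarrow> integrable circ (\<lambda>x. F x * cis (- (a * x)))"
  by (intro integrable_circ_mult_continuous continuous_on_cis_linear')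

lemma cis_has_vector_derivative:
  "((\<lambda>x. cis (a * x)) has_vector_derivative (\<i> * a * cis (a * x))) (at x within A)"
proof -
  have "((\<lambda>x. exp (\<i> * a * of_real x)) has_vector_derivative (exp (\<i> * a * of_real x) * (\<i> * a))) (at x within A)"
    by (rule has_vector_derivative_real_field) (auto intro!: derivative_eq_intros)
  then show ?thesis by (simp add: cis_conv_exp mult_ac)
qed

lemma integral_cis:
  "(LINT x|circ. cis (of_int n * x)) = (if n = 0 then of_real (2 * pi) else 0)"
proof (cases "n = 0")
  case True
  then show ?thesis by (simp add: scaleR_conv_of_real)
next
  case False
  let ?F = "\<lambda>x. cis (of_int n * x) / (\<i> * of_int n)"
  have "has_bochner_integral lborel (\<lambda>x. indicator {0..2 * pi} x *\<^sub>R cis (of_int n * x)) (?F (2 * pi) - ?F 0)"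
  proof (rule has_bochner_integral_FTC_Icc)
    fix x :: real
    have "((\<lambda>x. cis (of_int n * x)) has_vector_derivative (\<i> * of_int n * cis (of_int n * x))) (at x within {0..2 * pi})"
      using cis_has_vector_derivative[of "of_int n" x] by simp
    from has_vector_derivative_divide[OF this, of "\<i> * of_int n"]
    show "(?F has_vector_derivative cis (of_int n * x)) (at x within {0..2 * pi})"
      using False by simp
  qed (auto intro!: continuous_intros)
  moreover have "cis (of_int n * (2 * pi)) = 1"
    using cis_multiple_2pi[of "of_int n"] by (simp add: mult_ac)
  ultimately show ?thesis
    using False by (simp add: integral_restrict_space has_bochner_integral_integral_eq)
qed

lemma fc_add: "integrable circ F \<Longrightarrow> integrable circ G \<Longrightarrow> fc (\<lambda>x. F x + G x) n = fc F n + fc G n"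
  by (simp add: fc_def distrib_right integrable_mult_cis' distrib_left del: mult_minus_left)

lemma fc_diff: "integrable circ F \<Longrightarrow> integrable circ G \<Longrightarrow> fc (\<lambda>x. F x - G x) n = fc F n - fc G n"
  by (simp add: fc_def left_diff_distrib integrable_mult_cis' right_diff_distrib del: mult_minus_left)

lemma fc_cmult: "fc (\<lambda>x. c * F x) n = c * fc F n"
  by (simp add: fc_def mult.assoc)

lemma fc_sum:
  "(\<And>i. i \<in> S \<Longrightarrow> integrable circ (F i)) \<Longrightarrow> fc (\<lambda>x. \<Sum>i\<in>S. F i x) n = (\<Sum>i\<in>S. fc (F i) n)"
  by (simp add: fc_def sum_distrib_right sum_distrib_left integrable_mult_cis' del: mult_minus_left)

lemma fc_mult_cis: "fc (\<lambda>x. cis (of_int m * x) * F x) n = fc F (n - m)"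
proof -
  have "cis (of_int m * x) * F x * cis (- (of_int n * x)) = F x * cis (- (of_int (n - m) * x))" for x
  proof -
    have "cis (of_int m * x) * cis (- (of_int n * x)) = cis (- (of_int (n - m) * x))"
      by (simp add: cis_mult algebra_simps)
    then show ?thesis by (metis mult.assoc mult.commute)
  qed
  then show ?thesis by (simp only: fc_def)
qed

lemma fc_cnj: "fc (\<lambda>x. cnj (F x)) n = cnj (fc F (- n))"
proof -
  have "(LINT x|circ. cnj (F x) * cis (- (of_int n * x))) = (LINT x|circ. cnj (F x * cis (- (of_int (- n) * x))))"
    by (simp add: cis_cnj)
  also have "\<dots> = cnj (LINT x|circ. F x * cis (- (of_int (- n) * x)))"
    by (rule Bochner_Integration.integral_cnj)
  finally show ?thesis by (simp add: fc_def)
qed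

lemma fc_cong_AE:
  assumes "AE x in circ. F x = G x" "F \<in> borel_measurable circ" "G \<in> borel_measurable circ"
  shows "fc F n = fc G n"
proof -
  have [measurable]: "(\<lambda>x. cis (- (of_int n * x))) \<in> borel_measurable circ"
    by (intro borel_measurable_circ_continuous continuous_on_cis_linear')
  show ?thesis unfolding fc_def
    using assms by (intro arg_cong2[where f="(*)"] refl integral_cong_AE) auto
qed

lemma fc_cis: "fc (\<lambda>x. cis (of_int m * x)) n = (if n = m then 1 else 0)"
  using fc_mult_cis[of m "\<lambda>x. 1" n] integral_cis[of "m - n"] by (simp add: fc_def algebra_simps)

definition trig :: "int set \<Rightarrow> (int \<Rightarrow> complex) \<Rightarrow> real \<Rightarrow> complex" where
  "trig S c x = (\<Sum>n\<in>S. c n * cis (of_int n * x))"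

lemma continuous_on_trig [continuous_intros]: "continuous_on A (trig S c)"
  unfolding trig_def by (intro continuous_intros)

lemma fc_trig: "finite S \<Longrightarrow> fc (trig S c) n = (if n \<in> S then c n else 0)"
  unfolding trig_def
  by (subst fc_sum)
     (auto intro!: integrable_circ_continuous continuous_intros simp: fc_cmult fc_cis if_distrib cong: if_cong)

text \<open>A finite convolution. With it, products of general functions can be treated by
  truncating one factor only.\<close>

lemma fc_trig_mult:
  assumes "integrable circ G"
  shows "fc (\<lambda>x. trig S c x * G x) n = (\<Sum>j\<in>S. c j * fc G (n - j))"
proof -
  have "integrable circ (\<lambda>x. c j * (cis (of_int j * x) * G x))" for j
    using integrable_mult_cis[OF assms, of "of_int j"] by (simp add: mult.commute)
  then show ?thesis
    by (simp add: trig_def sum_distrib_right mult.assoc fc_sum fc_cmult fc_mult_cis)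
qed

lemma integral_mult_cnj_trig:
  assumes "integrable circ F"
  shows "(LINT x|circ. F x * cnj (trig S c x)) = 2 * pi * (\<Sum>n\<in>S. cnj (c n) * fc F n)"
proof -
  have "F x * cnj (trig S c x) = (\<Sum>n\<in>S. cnj (c n) * (F x * cis (- (of_int n * x))))" for x
    by (simp add: trig_def sum_distrib_left cis_cnj mult_ac)
  then have "(LINT x|circ. F x * cnj (trig S c x))
      = (\<Sum>n\<in>S. cnj (c n) * (LINT x|circ. F x * cis (- (of_int n * x))))"
    by (simp add: integrable_mult_cis'[OF assms] del: mult_minus_left)
  also have "\<dots> = 2 * pi * (\<Sum>n\<in>S. cnj (c n) * fc F n)"
    by (simp add: fc_def sum_distrib_left)
  finally show ?thesis .
qed

lemma mult_cnj_cmod: "z * cnj z = (of_real (cmod z))\<^sup>2"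
  by (metis complex_norm_square of_real_power)

section \<open>Bessel's inequality and the Riesz-Fischer theorem\<close>

lemma integral_norm_trig:
  assumes "finite S"
  shows "(LINT x|circ. (cmod (trig S c x))\<^sup>2) = 2 * pi * (\<Sum>n\<in>S. (cmod (c n))\<^sup>2)"
proof -
  have "of_real (LINT x|circ. (cmod (trig S c x))\<^sup>2) = (LINT x|circ. trig S c x * cnj (trig S c x))"
    by (simp add: mult_cnj_cmod flip: integral_complex_of_real)
  also have "\<dots> = 2 * pi * (\<Sum>n\<in>S. cnj (c n) * fc (trig S c) n)"
    by (intro integral_mult_cnj_trig integrable_circ_continuous continuous_intros)
  also have "\<dots> = of_real (2 * pi * (\<Sum>n\<in>S. (cmod (c n))\<^sup>2))"
    using assms by (simp add: fc_trig mult_cnj_cmod mult.commute)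
  finally show ?thesis by (simp only: of_real_eq_iff)
qed

text \<open>Expand the squared L2 distance between \<open>F\<close> and its own partial sum
  \<open>T\<close>: the cross integral and the squared norm of \<open>T\<close> both equal
  \<open>2 * pi * B\<close>.\<close>

lemma Bessel_inequality:
  assumes F: "sq_integrable circ F" and S: "finite S"
  shows "2 * pi * (\<Sum>n\<in>S. (cmod (fc F n))\<^sup>2) \<le> (LINT x|circ. (cmod (F x))\<^sup>2)"
proof -
  define T where "T = trig S (fc F)"
  define B where "B = (\<Sum>n\<in>S. (cmod (fc F n))\<^sup>2)"
  have T: "sq_integrable circ T"
    unfolding T_def by (intro sq_integrable_circ_continuous continuous_intros)
  have cT: "sq_integrable circ (\<lambda>x. cnj (T x))"
    unfolding T_def by (intro sq_integrable_circ_continuous continuous_intros)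
  have "(LINT x|circ. F x * cnj (T x)) = of_real (2 * pi * B)"
    unfolding T_def
    by (subst integral_mult_cnj_trig[OF circ.sq_integrable_imp_integrable[OF F]])
       (simp add: B_def mult_cnj_cmod mult.commute)
  then have FT: "(LINT x|circ. Re (F x * cnj (T x))) = 2 * pi * B"
    by (subst integral_Re) (use integrable_mult_sq_integrable[OF F cT] in simp_all)
  have TT: "(LINT x|circ. (cmod (T x))\<^sup>2) = 2 * pi * B"
    unfolding T_def B_def by (rule integral_norm_trig[OF S])
  have "0 \<le> (LINT x|circ. (cmod (F x - T x))\<^sup>2)" by simp
  also have "\<dots> = (LINT x|circ. (cmod (F x))\<^sup>2 - 2 * Re (F x * cnj (T x)) + (cmod (T x))\<^sup>2)"
    by (intro Bochner_Integration.integral_cong refl, unfold cmod_power2)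
       (simp add: power2_eq_square algebra_simps)
  also have "\<dots> = (LINT x|circ. (cmod (F x))\<^sup>2) - 2 * (2 * pi * B) + 2 * pi * B"
    using sq_integrableD[OF F] sq_integrableD[OF T] integrable_mult_sq_integrable[OF F cT]
    by (simp add: FT TT del: Re_complex_of_real times_complex.sel)
  finally show ?thesis by (simp add: B_def)
qed

text \<open>By Parseval's identity for finite sums, the squared distance of two symmetric partial
  sums is \<open>2 * pi\<close> times the difference of their sums of squares. These are monotone
  and bounded, so the partial sums are Cauchy in L2.\<close>

lemma Riesz_Fischer:
  assumes bd: "\<And>S. finite S \<Longrightarrow> (\<Sum>n\<in>S. (cmod (c n))\<^sup>2) \<le> K"
  obtains F where "sq_integrable circ F" "\<And>n. fc F n = c n"
    "(\<lambda>N. LINT x|circ. (cmod (trig {- int N..int N} c x - F x))\<^sup>2) \<longlonglongrightarrow> 0"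
proof -
  define A where "A N = {- int N..int N}" for N
  define a where "a N = (\<Sum>n\<in>A N. (cmod (c n))\<^sup>2)" for N
  have fin: "finite (A N)" for N by (simp add: A_def)
  have sub: "A M \<subseteq> A N" if "M \<le> N" for M N using that by (auto simp: A_def)
  have "incseq a" unfolding a_def by (intro incseq_SucI sum_mono2 fin sub) auto
  moreover have "a N \<le> K" for N unfolding a_def by (rule bd[OF fin])
  ultimately have "convergent a"
    by (metis convergent_def incseq_convergent)
  then have ca: "Cauchy a" by (simp add: Cauchy_convergent_iff)
  have diff: "(LINT x|circ. (cmod (trig (A N) c x - trig (A M) c x))\<^sup>2) = 2 * pi * (a N - a M)"
    if "M \<le> N" for M N
  proof -
    have "trig (A N) c x - trig (A M) c x = trig (A N - A M) c x" for x
      by (simp add: trig_def sum_diff[OF fin sub[OF that]])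
    then show ?thesis
      using fin by (simp add: integral_norm_trig a_def sum_diff[OF fin sub[OF that]])
  qed
  have diff': "(LINT x|circ. (cmod (trig (A N) c x - trig (A M) c x))\<^sup>2) = 2 * pi * \<bar>a N - a M\<bar>" for M N
  proof (cases "M \<le> N")
    case True
    moreover have "a M \<le> a N" using \<open>incseq a\<close> True by (auto simp: incseq_def)
    ultimately show ?thesis using diff by simp
  next
    case False
    then have "N \<le> M" by simp
    moreover have "a N \<le> a M" using \<open>incseq a\<close> \<open>N \<le> M\<close> by (auto simp: incseq_def)
    ultimately show ?thesis using diff[of N M] by (simp add: norm_minus_commute)
  qed
  have T: "sq_integrable circ (trig (A N) c)" for N
    by (intro sq_integrable_circ_continuous continuous_intros)
  obtain F where F: "sq_integrable circ F"
    "(\<lambda>N. LINT x|circ. (cmod (trig (A N) c x - F x))\<^sup>2) \<longlonglongrightarrow> 0"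
  proof (rule circ.L2_complete[OF T])
    fix e :: real assume "e > 0"
    then obtain N where "\<And>i j. i \<ge> N \<Longrightarrow> j \<ge> N \<Longrightarrow> \<bar>a i - a j\<bar> < e / (2 * pi)"
      using CauchyD[OF ca, of "e / (2 * pi)"] by auto
    then have "\<And>i j. i \<ge> N \<Longrightarrow> j \<ge> N \<Longrightarrow> 2 * pi * \<bar>a i - a j\<bar> < e"
      by (simp add: field_simps)
    then show "\<exists>N. \<forall>i\<ge>N. \<forall>j\<ge>N. (LINT x|circ. (cmod (trig (A i) c x - trig (A j) c x))\<^sup>2) < e"
      unfolding diff' by blast
  qed auto
  \<comment> \<open>A single coefficient is continuous in L2, and for the partial sums it equals
    \<open>c n\<close> as soon as \<open>N\<close> reaches the modulus of \<open>n\<close>.\<close>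
  have "fc F n = c n" for n
  proof (rule LIMSEQ_unique)
    have "sq_integrable circ (\<lambda>x. cis (- (of_int n * x)))"
      by (intro sq_integrable_circ_continuous continuous_on_cis_linear')
    from L2_tendsto_integral_mult[OF T F(1) this F(2)]
    show "(\<lambda>N. fc (trig (A N) c) n) \<longlonglongrightarrow> fc F n"
      unfolding fc_def by (intro tendsto_intros)
    show "(\<lambda>N. fc (trig (A N) c) n) \<longlonglongrightarrow> c n"
      by (intro tendsto_eventually eventually_sequentiallyI[of "nat \<bar>n\<bar>"])
         (auto simp: fc_trig A_def)
  qed
  then show thesis using F that unfolding A_def by blast
qed

section \<open>Uniqueness of Fourier coefficients\<close>

text \<open>A polynomial in \<open>cos x\<close> and \<open>sin x\<close> is a trigonometric
  polynomial, and each frequency only shifts the coefficients. The induction varies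
  \<open>f\<close>, because a product of polynomials is multiplied on one factor at a time.\<close>

lemma fc_zero_mult_polynomial:
  fixes p :: "complex \<Rightarrow> real"
  assumes "real_polynomial_function p" "integrable circ f" "\<And>n. fc f n = 0"
  shows "integrable circ (\<lambda>x. f x * of_real (p (cis x))) \<and> (\<forall>n. fc (\<lambda>x. f x * of_real (p (cis x))) n = 0)"
  using assms
proof (induction p arbitrary: f rule: real_polynomial_function.induct)
  case (linear p)
  \<comment> \<open>On the circle a real linear form of the plane is
    \<open>2 * Re (\<alpha> * cis x)\<close>, a combination of the frequencies 1 and -1.\<close>
  define \<alpha> where "\<alpha> = Complex (p 1 / 2) (- p \<i> / 2)"
  have p: "p (cis x) = cos x * p 1 + sin x * p \<i>" for x
  proof -
    interpret bounded_linear p by fact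
    have "cis x = cos x *\<^sub>R 1 + sin x *\<^sub>R \<i>" by (simp add: complex_eq_iff)
    then show ?thesis by (simp add: add scaleR)
  qed
  have eq: "f x * of_real (p (cis x))
      = \<alpha> * (cis (of_int 1 * x) * f x) + cnj \<alpha> * (cis (of_int (- 1) * x) * f x)" for x
    by (simp add: p complex_eq_iff \<alpha>_def algebra_simps)
  have int: "integrable circ (\<lambda>x. c * (cis (of_int j * x) * f x))" for j c
    using integrable_mult_cis[OF linear(2), of "of_int j"] by (simp add: mult.commute)
  show ?case
    unfolding eq by (auto simp only: int fc_add fc_cmult fc_mult_cis linear
        intro!: Bochner_Integration.integrable_add) auto
next
  case (const c)
  have "fc (\<lambda>x. f x * of_real c) n = of_real c * fc f n" for n
    using fc_cmult[of "of_real c" f n] by (simp only: mult.commute)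
  then show ?case using const by simp
next
  case (add p q)
  show ?case
    using add.IH(1)[OF add.prems] add.IH(2)[OF add.prems]
    by (simp add: distrib_left fc_add)
next
  case (mult p q)
  have eq: "f x * of_real (p (cis x) * q (cis x)) = f x * of_real (p (cis x)) * of_real (q (cis x))" for x
    by simp
  show ?case
    unfolding eq using mult.IH(1)[OF mult.prems] by (intro mult.IH(2)) auto
qed

text \<open>Writing the test function as \<open>g (cis x)\<close> builds in its periodicity; by
  Stone-Weierstrass it is a uniform limit of polynomials on the unit circle.\<close>

lemma fc_zero_integral_continuous:
  fixes g :: "complex \<Rightarrow> real"
  assumes f: "integrable circ f" "\<And>n. fc f n = 0" and g: "continuous_on UNIV g"
  shows "(LINT x|circ. f x * of_real (g (cis x))) = 0"
proof -
  define C where "C = (LINT x|circ. cmod (f x))"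
  have C: "C \<ge> 0" by (simp add: C_def)
  have "cmod (LINT x|circ. f x * of_real (g (cis x))) \<le> e" if e: "e > 0" for e
  proof -
    have d: "e / (C + 1) > 0" using e C by simp
    obtain p where p: "real_polynomial_function p" "\<And>z. z \<in> sphere 0 1 \<Longrightarrow> \<bar>g z - p z\<bar> < e / (C + 1)"
      using Stone_Weierstrass_real_polynomial_function[OF compact_sphere continuous_on_subset[OF g subset_UNIV] d]
      by metis
    have ip: "integrable circ (\<lambda>x. f x * of_real (p (cis x)))"
      and "fc (\<lambda>x. f x * of_real (p (cis x))) 0 = 0"
      using fc_zero_mult_polynomial[OF p(1) f] by auto
    then have zp: "(LINT x|circ. f x * of_real (p (cis x))) = 0"
      by (simp add: fc_def)
    have ig: "integrable circ (\<lambda>x. f x * of_real (g (cis x)))"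
      by (intro integrable_circ_mult_continuous f continuous_intros
          continuous_on_compose2[OF g]) auto
    have "cmod (LINT x|circ. f x * of_real (g (cis x)))
        = cmod (LINT x|circ. f x * of_real (g (cis x)) - f x * of_real (p (cis x)))"
      using zp ig ip by simp
    also have "\<dots> \<le> (LINT x|circ. cmod (f x * of_real (g (cis x)) - f x * of_real (p (cis x))))"
      by simp
    also have "\<dots> \<le> (LINT x|circ. e / (C + 1) * cmod (f x))"
    proof (rule integral_mono)
      fix x
      have "f x * of_real (g (cis x)) - f x * of_real (p (cis x)) = f x * of_real (g (cis x) - p (cis x))"
        by (simp add: algebra_simps)
      then have "cmod (f x * of_real (g (cis x)) - f x * of_real (p (cis x))) = cmod (f x) * \<bar>g (cis x) - p (cis x)\<bar>"
        by (metis norm_mult norm_of_real)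
      then show "cmod (f x * of_real (g (cis x)) - f x * of_real (p (cis x))) \<le> e / (C + 1) * cmod (f x)"
        using mult_left_mono[of "\<bar>g (cis x) - p (cis x)\<bar>" "e / (C + 1)" "cmod (f x)"] p(2)[of "cis x"]
        by (simp only: mult.commute[of "cmod (f x)"] norm_ge_zero) simp
    qed (use ig ip f in auto)
    also have "\<dots> = e / (C + 1) * C" by (simp add: C_def)
    also have "\<dots> \<le> e" using C e by (simp add: field_simps)
    finally show ?thesis .
  qed
  then show ?thesis using field_le_epsilon[of "cmod (LINT x|circ. f x * of_real (g (cis x)))" 0] by auto
qed

lemma fc_zero_integral_closed:
  assumes f: "integrable circ f" "\<And>n. fc f n = 0" and K: "closed K"
  shows "(LINT x|circ. indicator K (cis x) *\<^sub>R f x) = 0"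
proof (cases "K = {}")
  case False
  \<comment> \<open>Continuous cutoffs decreasing to the indicator of \<open>K\<close>: off the
    closed set the distance is positive, so they vanish from some \<open>j\<close> on. The empty set
    is treated apart because \<open>infdist\<close> to it is 0, which would make the cutoffs
    constantly 1.\<close>
  define g where "g j z = max 0 (1 - real j * infdist z K)" for j z
  have g: "continuous_on UNIV (g j)" for j
    unfolding g_def by (intro continuous_intros)
  have cg: "continuous_on UNIV (\<lambda>x. complex_of_real (g j (cis x)))" for j
    by (intro continuous_intros continuous_on_compose2[OF g]) auto
  have "(\<lambda>j. LINT x|circ. f x * of_real (g j (cis x))) \<longlonglongrightarrow> (LINT x|circ. indicator K (cis x) *\<^sub>R f x)"
  proof (rule integral_dominated_convergence[where w="\<lambda>x. cmod (f x)"])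
    have "(\<lambda>x. indicat_real K (cis x)) \<in> borel_measurable borel"
      by (rule measurable_compose[of cis borel borel])
         (use K in \<open>auto intro!: borel_measurable_continuous_onI continuous_intros borel_measurable_indicator\<close>)
    from borel_measurable_circ[OF this]
    show "(\<lambda>x. indicator K (cis x) *\<^sub>R f x) \<in> borel_measurable circ"
      using f by (intro borel_measurable_scaleR) auto
    show "(\<lambda>x. f x * of_real (g j (cis x))) \<in> borel_measurable circ" for j
      by (rule borel_measurable_times[OF borel_measurable_integrable[OF f(1)]
            borel_measurable_circ[OF borel_measurable_continuous_onI[OF cg]]])
    show "AE x in circ. (\<lambda>j. f x * of_real (g j (cis x))) \<longlonglongrightarrow> indicator K (cis x) *\<^sub>R f x"
    proof (rule AE_I2)
      fix x
      have "(\<lambda>j. g j z) \<longlonglongrightarrow> indicator K z" for z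
      proof (cases "z \<in> K")
        case True
        then show ?thesis by (simp add: g_def)
      next
        case out: False
        then have "infdist z K > 0" using K False infdist_pos_not_in_closed by blast
        then obtain n where n: "real n * infdist z K > 1" using ex_less_of_nat_mult by blast
        have "g j z = 0" if "j \<ge> n" for j
        proof -
          have "real n * infdist z K \<le> real j * infdist z K"
            using that infdist_nonneg[of z K] by (intro mult_right_mono) auto
          then show ?thesis using n by (simp add: g_def)
        qed
        then show ?thesis using out by (auto intro!: tendsto_eventually eventually_sequentiallyI)
      qed
      from tendsto_mult[OF tendsto_const tendsto_of_real[OF this]]
      show "(\<lambda>j. f x * of_real (g j (cis x))) \<longlonglongrightarrow> indicator K (cis x) *\<^sub>R f x"
        by (simp add: scaleR_conv_of_real mult.commute)
    qed
    show "AE x in circ. norm (f x * of_real (g j (cis x))) \<le> cmod (f x)" for j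
    proof (rule AE_I2)
      fix x
      have "\<bar>g j (cis x)\<bar> \<le> 1" by (simp add: g_def infdist_nonneg)
      then show "norm (f x * of_real (g j (cis x))) \<le> cmod (f x)"
        by (simp add: norm_mult mult_left_le)
    qed
  qed (use f in auto)
  then show ?thesis
    using LIMSEQ_unique[OF _ tendsto_const] by (simp add: fc_zero_integral_continuous[OF f g])
qed simp

lemma AE_circ_not_endpoint: "AE x in circ. x \<noteq> 2 * pi"
  by (subst AE_restrict_space_iff) (auto intro: AE_lborel_singleton eventually_mono[OF AE_lborel_singleton])

text \<open>Up to the endpoint \<open>2 * pi\<close>, a proper initial interval of the circle is the
  preimage under \<open>cis\<close> of a compact arc.\<close>

lemma fc_zero_integral_atMost:
  assumes f: "integrable circ f" "\<And>n. fc f n = 0"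
  shows "(LINT x|circ. indicator {..a} x *\<^sub>R f x) = 0"
proof (cases "a \<ge> 2 * pi")
  case True
  have "(LINT x|circ. indicator {..a} x *\<^sub>R f x) = (LINT x|circ. f x)"
    by (intro Bochner_Integration.integral_cong refl) (use True in auto)
  then show ?thesis using f(2)[of 0] by (simp add: fc_def)
next
  case False
  show ?thesis
  proof (cases "a \<ge> 0")
    case True
    define K where "K = cis ` {0..a}"
    have "closed K" unfolding K_def
      by (intro compact_imp_closed compact_continuous_image) (auto intro!: continuous_intros)
    from fc_zero_integral_closed[OF f this]
    have "(LINT x|circ. indicator K (cis x) *\<^sub>R f x) = 0" .
    moreover have "(LINT x|circ. indicator K (cis x) *\<^sub>R f x) = (LINT x|circ. indicator {..a} x *\<^sub>R f x)"
    proof (rule integral_cong_AE)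
      have "(\<lambda>x. indicat_real K (cis x)) \<in> borel_measurable borel"
        by (rule measurable_compose[of cis borel borel])
           (use \<open>closed K\<close> in \<open>auto intro!: borel_measurable_continuous_onI continuous_intros borel_measurable_indicator\<close>)
      from borel_measurable_circ[OF this]
      show "(\<lambda>x. indicator K (cis x) *\<^sub>R f x) \<in> borel_measurable circ"
        using f by (intro borel_measurable_scaleR) auto
      show "(\<lambda>x. indicator {..a} x *\<^sub>R f x) \<in> borel_measurable circ"
        by (intro borel_measurable_scaleR[OF borel_measurable_circ borel_measurable_integrable[OF f(1)]]) auto
      \<comment> \<open>The endpoint has to be removed: \<open>cis (2 * pi) = cis 0\<close> lies in
        \<open>K\<close>, whereas \<open>2 * pi\<close> exceeds \<open>a\<close>.\<close>
      show "AE x in circ. indicator K (cis x) *\<^sub>R f x = indicator {..a} x *\<^sub>R f x"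
        using AE_circ_not_endpoint AE_space[of circ]
      proof eventually_elim
        case (elim x)
        have "cis x \<in> K \<longleftrightarrow> x \<le> a"
        proof
          assume "cis x \<in> K"
          then obtain y where y: "y \<in> {0..a}" "cis x = cis y" by (auto simp: K_def)
          have "x = y"
          proof -
            have "cos x = cos y" "sin x = sin y" using y by (simp_all add: complex_eq_iff)
            then have "cos (x - y) = 1"
              using sin_cos_squared_add3[of y] by (simp add: cos_diff)
            then obtain n where n: "x - y = of_int n * 2 * pi"
              using cos_one_2pi_int by blast
            have "\<bar>x - y\<bar> < 2 * pi" using y elim False by auto
            then have "\<bar>real_of_int n\<bar> * (2 * pi) < 1 * (2 * pi)"
              unfolding n by (simp add: abs_mult mult.assoc)
            then have "\<bar>real_of_int n\<bar> < 1" by (simp only: mult_less_cancel_right) auto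
            then have "n = 0" by linarith
            then show ?thesis using n by simp
          qed
          then show "x \<le> a" using y by simp
        qed (use elim in \<open>auto simp: K_def\<close>)
        then show ?case by (auto simp: indicator_def)
      qed
    qed
    ultimately show ?thesis by simp
  next
    case neg: False
    have "(LINT x|circ. indicator {..a} x *\<^sub>R f x) = (LINT x|circ. 0)"
      by (intro Bochner_Integration.integral_cong refl) (use neg in auto)
    then show ?thesis by simp
  qed
qed

text \<open>Dynkin's argument: half-lines are stable under intersection and generate the Borel sets,
  and vanishing of the integral passes to complements and to countable disjoint unions.\<close>

lemma integral_indicator_borel_eq_zero:
  fixes f :: "real \<Rightarrow> 'b::{banach, second_countable_topology}"
  assumes f: "integrable circ f" and atMost: "\<And>a. (LINT x|circ. indicator {..a} x *\<^sub>R f x) = 0"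
    and B: "B \<in> sets borel"
  shows "(LINT x|circ. indicator B x *\<^sub>R f x) = 0"
proof -
  have int: "integrable circ (\<lambda>x. indicator A x *\<^sub>R f x)" if "A \<in> sets borel" for A
  proof (rule Bochner_Integration.integrable_bound[OF integrable_norm[OF f]])
    show "(\<lambda>x. indicator A x *\<^sub>R f x) \<in> borel_measurable circ"
      using that by (intro borel_measurable_scaleR[OF borel_measurable_circ borel_measurable_integrable[OF f]]) auto
  qed (auto simp: indicator_def)
  \<comment> \<open>Complements require the total integral to vanish; the half-line up to
    \<open>2 * pi\<close> covers the whole circle.\<close>
  have all: "(LINT x|circ. f x) = 0"
  proof -
    have "(LINT x|circ. f x) = (LINT x|circ. indicator {..2 * pi} x *\<^sub>R f x)"
      by (intro Bochner_Integration.integral_cong refl) auto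
    then show ?thesis using atMost by simp
  qed
  have "Int_stable (range (\<lambda>a::real. {..a}))"
    by (auto simp: Int_stable_def intro: range_eqI[of _ _ "min _ _"])
  moreover have "range (\<lambda>a::real. {..a}) \<subseteq> Pow UNIV" by auto
  moreover have "B \<in> sigma_sets UNIV (range (\<lambda>a::real. {..a}))"
    using B by (simp add: borel_eq_atMost)
  ultimately show ?thesis
  proof (induction rule: sigma_sets_induct_disjoint)
    case (basic A)
    then show ?case using atMost by auto
  next
    case empty
    then show ?case by simp
  next
    case (compl A)
    then have A: "A \<in> sets borel" by (simp add: borel_eq_atMost)
    have "(LINT x|circ. indicator (UNIV - A) x *\<^sub>R f x) = (LINT x|circ. f x - indicator A x *\<^sub>R f x)"
      by (intro Bochner_Integration.integral_cong refl) (auto simp: indicator_def)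
    then show ?case using compl int[OF A] f all by simp
  next
    case (union A)
    then have A: "A i \<in> sets borel" for i by (auto simp: borel_eq_atMost)
    have sA: "A i \<inter> {0..2 * pi} \<in> sets circ" for i using A[of i] by (auto simp: sets_restrict_space)
    have dA: "\<And>i j. i \<noteq> j \<Longrightarrow> (A i \<inter> {0..2 * pi}) \<inter> (A j \<inter> {0..2 * pi}) = {}"
      using union(1) by (auto simp: disjoint_family_on_def)
    have eq: "(LINT x|circ. indicator C x *\<^sub>R f x) = (LINT x:C \<inter> {0..2 * pi}|circ. f x)" for C
      unfolding set_lebesgue_integral_def
      by (intro Bochner_Integration.integral_cong refl) (auto simp: indicator_def)
    have un: "(\<Union>i. A i) \<inter> {0..2 * pi} = (\<Union>i. A i \<inter> {0..2 * pi})" by blast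
    have i: "set_integrable circ (\<Union>i. A i \<inter> {0..2 * pi}) f"
      unfolding set_integrable_def
      by (intro integrable_mult_indicator f(1) sets.countable_UN) (use sA in blast)
    have "(LINT x|circ. indicator (\<Union>i. A i) x *\<^sub>R f x) = (\<Sum>i. LINT x:A i \<inter> {0..2 * pi}|circ. f x)"
      unfolding eq un by (rule lebesgue_integral_countable_add[OF sA dA i])
    also have "\<dots> = (\<Sum>i. 0)" by (simp only: eq[symmetric] union(3))
    finally show ?case by simp
  qed
qed

theorem fc_eq_zero_imp_AE_zero:
  assumes f: "integrable circ f" "\<And>n. fc f n = 0"
  shows "AE x in circ. f x = 0"
proof (rule circ.density_zero[OF f(1)])
  fix A assume "A \<in> sets circ"
  then obtain B where B: "B \<in> sets borel" "A = {0..2 * pi} \<inter> B"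
    by (auto simp: sets_restrict_space)
  have "(LINT x:A|circ. f x) = (LINT x|circ. indicator B x *\<^sub>R f x)"
    unfolding set_lebesgue_integral_def B(2)
    by (intro Bochner_Integration.integral_cong refl) (auto simp: indicator_def)
  also have "\<dots> = 0"
    by (rule integral_indicator_borel_eq_zero[OF f(1) fc_zero_integral_atMost[OF f] B(1)])
  finally show "(LINT x:A|circ. f x) = 0" .
qed

lemma fc_eq_imp_AE_eq:
  assumes "integrable circ F" "integrable circ G" "\<And>n. fc F n = fc G n"
  shows "AE x in circ. F x = G x"
  using fc_eq_zero_imp_AE_zero[of "\<lambda>x. F x - G x"] assms by (simp add: fc_diff)

text \<open>Riesz-Fischer provides an L2 limit of the partial sums that has the coefficients of
  \<open>F\<close>; uniqueness of coefficients identifies it with \<open>F\<close>.\<close>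

lemma trig_tendsto_L2:
  assumes F: "sq_integrable circ F"
  shows "(\<lambda>N. LINT x|circ. (cmod (trig {- int N..int N} (fc F) x - F x))\<^sup>2) \<longlonglongrightarrow> 0"
proof -
  have bd: "(\<Sum>n\<in>S. (cmod (fc F n))\<^sup>2) \<le> (LINT x|circ. (cmod (F x))\<^sup>2) / (2 * pi)" if "finite S" for S
    using Bessel_inequality[OF F that] by (simp add: field_simps)
  obtain G where G: "sq_integrable circ G" "\<And>n. fc G n = fc F n"
    "(\<lambda>N. LINT x|circ. (cmod (trig {- int N..int N} (fc F) x - G x))\<^sup>2) \<longlonglongrightarrow> 0"
    using Riesz_Fischer[OF bd] by blast
  have ae: "AE x in circ. G x = F x"
    using G F by (intro fc_eq_imp_AE_eq circ.sq_integrable_imp_integrable) auto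
  have "(LINT x|circ. (cmod (trig {- int N..int N} (fc F) x - G x))\<^sup>2)
      = (LINT x|circ. (cmod (trig {- int N..int N} (fc F) x - F x))\<^sup>2)" for N
  proof -
    have T: "sq_integrable circ (trig {- int N..int N} (fc F))"
      by (intro sq_integrable_circ_continuous continuous_intros)
    note [measurable] = sq_integrable_measurable[OF T] sq_integrable_measurable[OF F]
      sq_integrable_measurable[OF G(1)]
    show ?thesis
    proof (rule integral_cong_AE)
      show "AE x in circ. (cmod (trig {- int N..int N} (fc F) x - G x))\<^sup>2
          = (cmod (trig {- int N..int N} (fc F) x - F x))\<^sup>2"
        using ae by eventually_elim simp
    qed measurable
  qed
  then show ?thesis using G(3) by simp
qed

section \<open>Absolutely continuous functions\<close>

text \<open>Absolute continuity, with a derivative determined up to null sets. Using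
  \<open>has_bochner_integral\<close> includes integrability of \<open>v\<close>, so that no default
  value of the integral can satisfy the equation.\<close>

definition ac_deriv_on :: "real \<Rightarrow> real \<Rightarrow> (real \<Rightarrow> 'b::euclidean_space) \<Rightarrow> (real \<Rightarrow> 'b) \<Rightarrow> bool" where
  "ac_deriv_on c d F v \<longleftrightarrow> (\<forall>a b. c \<le> a \<longrightarrow> a \<le> b \<longrightarrow> b \<le> d \<longrightarrow>
     has_bochner_integral lborel (\<lambda>x. indicator {a..b} x *\<^sub>R v x) (F b - F a))"

lemma ac_deriv_onD:
  "ac_deriv_on c d F v \<Longrightarrow> c \<le> a \<Longrightarrow> a \<le> b \<Longrightarrow> b \<le> d \<Longrightarrow>
     has_bochner_integral lborel (\<lambda>x. indicator {a..b} x *\<^sub>R v x) (F b - F a)"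
  by (simp add: ac_deriv_on_def)

lemma ac_deriv_on_bounded_linear:
  assumes "bounded_linear T" "ac_deriv_on c d F v"
  shows "ac_deriv_on c d (\<lambda>x. T (F x)) (\<lambda>x. T (v x))"
  unfolding ac_deriv_on_def
proof (intro allI impI)
  interpret bounded_linear T by fact
  fix a b assume "c \<le> a" "a \<le> b" "b \<le> d"
  from has_bochner_integral_bounded_linear[OF assms(1) ac_deriv_onD[OF assms(2) this]]
  show "has_bochner_integral lborel (\<lambda>x. indicat_real {a..b} x *\<^sub>R T (v x)) (T (F b) - T (F a))"
    by (simp add: diff scaleR)
qed

lemma ac_deriv_on_add:
  assumes "ac_deriv_on c d F v" "ac_deriv_on c d G z"
  shows "ac_deriv_on c d (\<lambda>x. F x + G x) (\<lambda>x. v x + z x)"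
  unfolding ac_deriv_on_def
proof (intro allI impI)
  fix a b assume "c \<le> a" "a \<le> b" "b \<le> d"
  from has_bochner_integral_add[OF ac_deriv_onD[OF assms(1) this] ac_deriv_onD[OF assms(2) this]]
  show "has_bochner_integral lborel (\<lambda>x. indicat_real {a..b} x *\<^sub>R (v x + z x)) (F b + G b - (F a + G a))"
    by (simp add: scaleR_add_right algebra_simps)
qed

lemma ac_deriv_on_const: "ac_deriv_on c d (\<lambda>x. k) (\<lambda>x. 0)"
  by (simp add: ac_deriv_on_def has_bochner_integral_iff)

lemma ac_deriv_on_C1:
  assumes "\<And>x. x \<in> {c..d} \<Longrightarrow> (F has_vector_derivative v x) (at x within {c..d})" "continuous_on {c..d} v"
  shows "ac_deriv_on c d F v"
  unfolding ac_deriv_on_def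
proof (intro allI impI)
  fix a b assume ab: "c \<le> a" "a \<le> b" "b \<le> d"
  show "has_bochner_integral lborel (\<lambda>x. indicat_real {a..b} x *\<^sub>R v x) (F b - F a)"
    using ab by (intro has_bochner_integral_FTC_Icc)
      (auto intro!: has_vector_derivative_within_subset[OF assms(1)] continuous_on_subset[OF assms(2)])
qed

lemma ac_deriv_on_continuous:
  assumes F: "ac_deriv_on c d F v"
  shows "continuous_on {c..d} F"
proof (cases "c \<le> d")
  case True
  have int: "set_integrable lborel {c..x} v" if "x \<in> {c..d}" for x
    using ac_deriv_onD[OF F, of c x] that by (simp add: set_integrable_def has_bochner_integral_iff)
  have eq: "F x = F c + integral {c..x} v" if "x \<in> {c..d}" for x
    using ac_deriv_onD[OF F, of c x] that set_borel_integral_eq_integral(2)[OF int[OF that]]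
    by (simp add: set_lebesgue_integral_def has_bochner_integral_iff diff_eq_eq add.commute)
  have "continuous_on {c..d} (\<lambda>x. F c + integral {c..x} v)"
    using set_borel_integral_eq_integral(1)[OF int[of d]] True
    by (intro continuous_intros indefinite_integral_continuous_1) auto
  then show ?thesis by (rule continuous_on_eq) (rule eq[symmetric])
qed simp

text \<open>Both sides integrate \<open>v x * z t\<close> over the half-plane
  \<open>t \<le> x\<close>, in the two possible orders.\<close>

lemma Fubini_triangle:
  fixes v z :: "real \<Rightarrow> 'b::{euclidean_space, real_normed_algebra}"
  assumes v: "integrable lborel v" and z: "integrable lborel z"
  defines "P \<equiv> \<lambda>x. v x * (\<integral>t. (if t \<le> x then z t else 0) \<partial>lborel)"
    and "R \<equiv> \<lambda>t. (\<integral>x. (if t \<le> x then v x else 0) \<partial>lborel) * z t"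
  shows "integrable lborel P" "integrable lborel R" "integral\<^sup>L lborel P = integral\<^sup>L lborel R"
proof -
  have [measurable]: "v \<in> borel_measurable borel" "z \<in> borel_measurable borel"
    using borel_measurable_integrable[OF v] borel_measurable_integrable[OF z] by auto
  define h where "h x t = v x * (if t \<le> x then z t else 0)" for x t
  have [measurable]: "case_prod h \<in> borel_measurable (lborel \<Otimes>\<^sub>M lborel)"
    unfolding h_def by measurable
  have zx: "integrable lborel (\<lambda>t. if t \<le> x then z t else 0)" for x
    by (rule Bochner_Integration.integrable_bound[OF z]) (auto intro: measurable_If)
  have vt: "integrable lborel (\<lambda>x. if t \<le> x then v x else 0)" for t
    by (rule Bochner_Integration.integrable_bound[OF v]) (auto intro: measurable_If)
  have hx: "integrable lborel (h x)" for x
    unfolding h_def using zx by simp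
  have le: "norm (h x t) \<le> norm (v x) * norm (z t)" for x t
    using norm_mult_ineq[of "v x" "z t"] by (auto simp: h_def)
  have int: "integrable (lborel \<Otimes>\<^sub>M lborel) (case_prod h)"
  proof (rule lborel_pair.Fubini_integrable)
    show "integrable lborel (\<lambda>x. \<integral>y. norm (case_prod h (x, y)) \<partial>lborel)"
    proof (rule Bochner_Integration.integrable_bound)
      show "integrable lborel (\<lambda>x. norm (v x) * (\<integral>t. norm (z t) \<partial>lborel))"
        using v by simp
      show "(\<lambda>x. \<integral>y. norm (case_prod h (x, y)) \<partial>lborel) \<in> borel_measurable lborel"
        by measurable
      show "AE x in lborel. norm (\<integral>y. norm (case_prod h (x, y)) \<partial>lborel)
          \<le> norm (norm (v x) * (\<integral>t. norm (z t) \<partial>lborel))"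
      proof (rule AE_I2)
        fix x
        have "(\<integral>y. norm (h x y) \<partial>lborel) \<le> (\<integral>t. norm (v x) * norm (z t) \<partial>lborel)"
          using z hx by (intro integral_mono le) auto
        then show "norm (\<integral>y. norm (case_prod h (x, y)) \<partial>lborel)
          \<le> norm (norm (v x) * (\<integral>t. norm (z t) \<partial>lborel))"
          by (simp add: abs_mult)
      qed
    qed
  qed (use hx in simp_all)
  have P: "P x = (\<integral>t. h x t \<partial>lborel)" for x
    unfolding P_def h_def using zx by simp
  have R: "R t = (\<integral>x. h x t \<partial>lborel)" for t
  proof -
    have "h x t = (if t \<le> x then v x else 0) * z t" for x by (simp add: h_def)
    then show ?thesis unfolding R_def using vt by simp
  qed
  show "integrable lborel P" unfolding P by (rule lborel_pair.integrable_fst[OF int])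
  show "integrable lborel R" unfolding R by (rule lborel_pair.integrable_snd[OF int])
  show "integral\<^sup>L lborel P = integral\<^sup>L lborel R"
    unfolding P R using lborel_pair.Fubini_integral[OF int] by simp
qed

text \<open>The derivatives are only integrable, so the product rule is not taken pointwise; it
  comes from exchanging the integrals over the triangle
  \<open>a \<le> t \<le> x \<le> b\<close>.\<close>

lemma ac_deriv_on_mult:
  fixes F G :: "real \<Rightarrow> 'b::{euclidean_space, real_normed_algebra}"
  assumes F: "ac_deriv_on c d F v" and G: "ac_deriv_on c d G z"
  shows "ac_deriv_on c d (\<lambda>x. F x * G x) (\<lambda>x. v x * G x + F x * z x)"
  unfolding ac_deriv_on_def
proof (intro allI impI)
  fix a b assume ab: "c \<le> a" "a \<le> b" "b \<le> d"
  define v' where "v' x = indicator {a..b} x *\<^sub>R v x" for x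
  define z' where "z' x = indicator {a..b} x *\<^sub>R z x" for x
  have v': "has_bochner_integral lborel v' (F b - F a)"
    and z': "has_bochner_integral lborel z' (G b - G a)"
    unfolding v'_def z'_def using ac_deriv_onD[OF F ab] ac_deriv_onD[OF G ab] by auto
  have P: "v' x * (\<integral>t. (if t \<le> x then z' t else 0) \<partial>lborel) = v' x * (G x - G a)" for x
  proof (cases "x \<in> {a..b}")
    case True
    have "(\<lambda>t. if t \<le> x then z' t else 0) = (\<lambda>t. indicator {a..x} t *\<^sub>R z t)"
      using True by (auto simp: z'_def indicator_def)
    then show ?thesis
      using ac_deriv_onD[OF G, of a x] True ab by (simp add: has_bochner_integral_iff)
  qed (simp add: v'_def)
  have R: "(\<integral>x. (if t \<le> x then v' x else 0) \<partial>lborel) * z' t = (F b - F t) * z' t" for t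
  proof (cases "t \<in> {a..b}")
    case True
    have "(\<lambda>x. if t \<le> x then v' x else 0) = (\<lambda>x. indicator {t..b} x *\<^sub>R v x)"
      using True by (auto simp: v'_def indicator_def)
    then show ?thesis
      using ac_deriv_onD[OF F, of t b] True ab by (simp add: has_bochner_integral_iff)
  qed (simp add: z'_def)
  note fub = Fubini_triangle[OF integrable.intros[OF v'] integrable.intros[OF z'], unfolded P R]
  define I where "I = (\<integral>x. v' x * (G x - G a) \<partial>lborel)"
  have 1: "has_bochner_integral lborel (\<lambda>x. v' x * (G x - G a)) I"
    unfolding I_def by (rule has_bochner_integral_integrable[OF fub(1)])
  have 2: "has_bochner_integral lborel (\<lambda>x. (F b - F x) * z' x) I"
    unfolding I_def fub(3) by (rule has_bochner_integral_integrable[OF fub(2)])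
  have 3: "has_bochner_integral lborel (\<lambda>x. v' x * G a) ((F b - F a) * G a)"
    using v' by (rule has_bochner_integral_mult_left)
  have 4: "has_bochner_integral lborel (\<lambda>x. F b * z' x) (F b * (G b - G a))"
    using z' by (rule has_bochner_integral_mult_right)
  \<comment> \<open>The double integral \<open>I\<close> occurs with both signs and cancels, leaving
    the boundary terms.\<close>
  have "has_bochner_integral lborel
      (\<lambda>x. (v' x * (G x - G a) + v' x * G a) + (F b * z' x - (F b - F x) * z' x))
      ((I + (F b - F a) * G a) + (F b * (G b - G a) - I))"
    by (intro has_bochner_integral_add has_bochner_integral_diff 1 2 3 4)
  also have "(\<lambda>x. (v' x * (G x - G a) + v' x * G a) + (F b * z' x - (F b - F x) * z' x))
      = (\<lambda>x. indicat_real {a..b} x *\<^sub>R (v x * G x + F x * z x))"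
    by (auto simp: v'_def z'_def algebra_simps indicator_def)
  also have "(I + (F b - F a) * G a) + (F b * (G b - G a) - I) = F b * G b - F a * G a"
    by (simp add: algebra_simps)
  finally show "has_bochner_integral lborel
     (\<lambda>x. indicat_real {a..b} x *\<^sub>R (v x * G x + F x * z x)) (F b * G b - F a * G a)" .
qed

lemma has_bochner_integral_except_point:
  fixes f g :: "real \<Rightarrow> 'b::{banach, second_countable_topology}"
  assumes "\<And>x. x \<noteq> b \<Longrightarrow> f x = g x"
  shows "has_bochner_integral lborel f I \<longleftrightarrow> has_bochner_integral lborel g I"
  by (rule has_bochner_integral_discrete_difference[of "{b}"]) (use assms in auto)

text \<open>Translation invariance moves the identity by whole periods, and adjacent intervals are
  glued or cut; their common endpoint is a null set.\<close>

lemma ac_deriv_on_periodic: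
  fixes F v :: "real \<Rightarrow> 'b::euclidean_space"
  assumes F: "ac_deriv_on 0 (2 * pi) F v"
    and per: "\<And>x. F (x + 2 * pi) = F x" "\<And>x. v (x + 2 * pi) = v x"
  shows "ac_deriv_on c d F v"
proof -
  define I where "I a b \<longleftrightarrow> has_bochner_integral lborel (\<lambda>x. indicator {a..b} x *\<^sub>R v x) (F b - F a)" for a b
  have base: "I a b" if "0 \<le> a" "a \<le> b" "b \<le> 2 * pi" for a b
    unfolding I_def by (rule ac_deriv_onD[OF F that])
  have shift: "I a b \<longleftrightarrow> I (a + 2 * pi) (b + 2 * pi)" for a b
  proof -
    have "indicator {a + 2 * pi..b + 2 * pi} (2 * pi + 1 * x) *\<^sub>R v (2 * pi + 1 * x) = indicator {a..b} x *\<^sub>R v x" for x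
      using per(2)[of x] by (auto simp: indicator_def add.commute)
    then show ?thesis
      unfolding I_def per
      by (subst (2) lborel_has_bochner_integral_real_affine_iff[where c=1 and t="2 * pi"]) auto
  qed
  have add: "I a e" if "I a b" "I b e" "a \<le> b" "b \<le> e" for a b e
  proof -
    have "has_bochner_integral lborel (\<lambda>x. indicator {a..b} x *\<^sub>R v x + indicator {b..e} x *\<^sub>R v x) (F e - F a)"
      using has_bochner_integral_add[OF that(1,2)[unfolded I_def]] by simp
    then show ?thesis
      unfolding I_def
      by (rule has_bochner_integral_except_point[where b=b, THEN iffD1, rotated])
         (use that in \<open>auto simp: indicator_def\<close>)
  qed
  have sub: "I b e" if "I a e" "I a b" "a \<le> b" "b \<le> e" for a b e
  proof -
    have "has_bochner_integral lborel (\<lambda>x. indicator {a..e} x *\<^sub>R v x - indicator {a..b} x *\<^sub>R v x) (F e - F b)"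
      using has_bochner_integral_diff[OF that(1,2)[unfolded I_def]] by simp
    then show ?thesis
      unfolding I_def
      by (rule has_bochner_integral_except_point[where b=b, THEN iffD1, rotated])
         (use that in \<open>auto simp: indicator_def\<close>)
  qed
  have I0: "I 0 b" if "0 \<le> b" "b \<le> 2 * pi * real n" for b n
    using that
  proof (induction n arbitrary: b)
    case 0
    then show ?case using base[of 0 b] by simp
  next
    case (Suc n)
    show ?case
    proof (cases "b \<le> 2 * pi")
      case True
      then show ?thesis using base[of 0 b] Suc by simp
    next
      case False
      then have "I 0 (b - 2 * pi)" using Suc by (intro Suc.IH) (auto simp: algebra_simps)
      then have "I (2 * pi) b" using shift[of 0 "b - 2 * pi"] by simp
      then show ?thesis using add[of 0 "2 * pi" b] base[of 0 "2 * pi"] False by simp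
    qed
  qed
  have pos: "I a b" if "0 \<le> a" "a \<le> b" for a b
  proof -
    obtain n where "b / (2 * pi) \<le> real n" using real_arch_simple by blast
    then have "b \<le> 2 * pi * real n" by (simp add: field_simps)
    then show ?thesis using sub[of 0 b a] I0[of b n] I0[of a n] that by simp
  qed
  have "I a b" if "- (2 * pi * real n) \<le> a" "a \<le> b" for a b n
    using that
  proof (induction n arbitrary: a b)
    case 0
    then show ?case using pos by simp
  next
    case (Suc n)
    then have "I (a + 2 * pi) (b + 2 * pi)" by (intro Suc.IH) (auto simp: algebra_simps)
    then show ?case using shift by simp
  qed
  moreover obtain n where "- c / (2 * pi) \<le> real n" using real_arch_simple by blast
  then have "- (2 * pi * real n) \<le> c" by (simp add: field_simps)
  ultimately show ?thesis
    unfolding ac_deriv_on_def using I_def by (meson order_trans)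
qed

text \<open>Only the values on \<open>[0, 2 * pi)\<close> are read; the value at
  \<open>2 * pi\<close> is replaced by the one at 0.\<close>

definition per_ext :: "(real \<Rightarrow> 'b) \<Rightarrow> real \<Rightarrow> 'b" where
  "per_ext F x = F (x - 2 * pi * of_int \<lfloor>x / (2 * pi)\<rfloor>)"

lemma per_ext_periodic: "per_ext F (x + 2 * pi) = per_ext F x"
proof -
  have "(x + 2 * pi) / (2 * pi) = x / (2 * pi) + 1" by (simp add: field_simps)
  then have "\<lfloor>(x + 2 * pi) / (2 * pi)\<rfloor> = \<lfloor>x / (2 * pi)\<rfloor> + 1" by simp
  then show ?thesis by (simp add: per_ext_def algebra_simps)
qed

lemma per_ext_eq: "0 \<le> x \<Longrightarrow> x < 2 * pi \<Longrightarrow> per_ext F x = F x"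
proof -
  assume "0 \<le> x" "x < 2 * pi"
  then have "\<lfloor>x / (2 * pi)\<rfloor> = 0" by (intro floor_unique) (auto simp: field_simps)
  then show ?thesis by (simp add: per_ext_def)
qed

lemma per_ext_eq': "0 \<le> x \<Longrightarrow> x \<le> 2 * pi \<Longrightarrow> F (2 * pi) = F 0 \<Longrightarrow> per_ext F x = F x"
  using per_ext_eq[of x F] per_ext_eq[of 0 F] per_ext_periodic[of F 0] by (cases "x = 2 * pi") auto

lemma borel_measurable_per_ext [measurable]:
  "F \<in> borel_measurable borel \<Longrightarrow> per_ext F \<in> borel_measurable borel"
proof -
  assume F: "F \<in> borel_measurable borel"
  have "(\<lambda>x. x - 2 * pi * of_int \<lfloor>x / (2 * pi)\<rfloor>) \<in> borel_measurable borel" by measurable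
  from measurable_compose[OF this F] show ?thesis by (simp add: per_ext_def[abs_def])
qed

lemma periodic_eqI_circ:
  fixes f g :: "real \<Rightarrow> 'b"
  assumes per: "\<And>x. f (x + 2 * pi) = f x" "\<And>x. g (x + 2 * pi) = g x"
    and eq: "\<And>x. 0 \<le> x \<Longrightarrow> x < 2 * pi \<Longrightarrow> f x = g x"
  shows "f x = g x"
proof -
  have shift: "h (x + 2 * pi * of_int n) = h x" if "\<And>x. h (x + 2 * pi) = h x" for h :: "real \<Rightarrow> 'b" and x n
  proof (induction n arbitrary: x rule: int_induct[where k=0])
    case (step1 i)
    then show ?case using that[of "x + 2 * pi * of_int i"] by (simp add: algebra_simps)
  next
    case (step2 i)
    then show ?case using that[of "x + 2 * pi * of_int (i - 1)"] by (simp add: algebra_simps)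
  qed simp
  define n where "n = \<lfloor>x / (2 * pi)\<rfloor>"
  define y where "y = x - 2 * pi * of_int n"
  have "of_int n \<le> x / (2 * pi)" "x / (2 * pi) < of_int n + 1" unfolding n_def by linarith+
  then have "0 \<le> y" "y < 2 * pi" by (simp_all add: y_def field_simps)
  then have "f y = g y" by (rule eq)
  moreover have "f x = f y" "g x = g y"
    using shift[of f y n] shift[of g y n] per by (simp_all add: y_def)
  ultimately show ?thesis by simp
qed

lemma ac_deriv_on_circ:
  assumes "ac_deriv_on 0 (2 * pi) F v"
  shows "integrable circ v" "(LINT x|circ. v x) = F (2 * pi) - F 0"
  using ac_deriv_onD[OF assms, of 0 "2 * pi"]
  by (simp_all add: has_bochner_integral_iff integrable_restrict_space integral_restrict_space)

lemma ac_deriv_on_indefinite: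
  fixes v :: "real \<Rightarrow> 'b::euclidean_space"
  assumes v: "integrable circ v"
  shows "ac_deriv_on 0 (2 * pi) (\<lambda>x. \<integral>t. indicator {0..x} t *\<^sub>R v t \<partial>lborel) v"
proof -
  have int: "integrable lborel (\<lambda>t. indicator {a..b} t *\<^sub>R v t)" if "0 \<le> a" "b \<le> 2 * pi" for a b
  proof -
    have "integrable lborel (\<lambda>t. indicator {a..b} t *\<^sub>R (indicator {0..2 * pi} t *\<^sub>R v t))"
      using v by (intro integrable_mult_indicator[of "{a..b}" lborel "\<lambda>t. indicator {0..2 * pi} t *\<^sub>R v t"])
        (auto simp: integrable_restrict_space)
    also have "(\<lambda>t. indicator {a..b} t *\<^sub>R (indicator {0..2 * pi} t *\<^sub>R v t)) = (\<lambda>t. indicator {a..b} t *\<^sub>R v t)"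
      using that by (auto simp: indicator_def)
    finally show ?thesis .
  qed
  show ?thesis
    unfolding ac_deriv_on_def has_bochner_integral_iff
  proof (intro allI impI conjI int)
    fix a b :: real assume ab: "0 \<le> a" "a \<le> b" "b \<le> 2 * pi"
    have "(\<integral>t. indicator {a..b} t *\<^sub>R v t \<partial>lborel)
        = (\<integral>t. indicator {0..b} t *\<^sub>R v t - indicator {0..a} t *\<^sub>R v t \<partial>lborel)"
      by (rule integral_discrete_difference[of "{a}"]) (use ab in \<open>auto simp: indicator_def\<close>)
    also have "\<dots> = (\<integral>t. indicator {0..b} t *\<^sub>R v t \<partial>lborel) - (\<integral>t. indicator {0..a} t *\<^sub>R v t \<partial>lborel)"
      using int[of 0] ab by simp
    finally show "(\<integral>t. indicator {a..b} t *\<^sub>R v t \<partial>lborel) =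
       (\<integral>t. indicator {0..b} t *\<^sub>R v t \<partial>lborel) - (\<integral>t. indicator {0..a} t *\<^sub>R v t \<partial>lborel)" .
  qed auto
qed

text \<open>Integration by parts against \<open>cis (- n * x)\<close>; the boundary terms cancel by
  periodicity.\<close>

lemma fc_ac_deriv:
  assumes F: "ac_deriv_on 0 (2 * pi) F v" and per: "F (2 * pi) = F 0"
  shows "fc v n = \<i> * of_int n * fc F n"
proof -
  define e where "e x = cis (of_int (- n) * x)" for x
  have "ac_deriv_on 0 (2 * pi) e (\<lambda>x. \<i> * of_int (- n) * e x)"
    unfolding e_def
    using cis_has_vector_derivative[of "of_int (- n)"]
    by (intro ac_deriv_on_C1 continuous_intros) simp
  note m = ac_deriv_on_circ[OF ac_deriv_on_mult[OF F this]]
  have "e (2 * pi) = e 0"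
    using cis_multiple_2pi[of "of_int (- n)"] by (simp add: e_def mult_ac)
  have "v x * e x + F x * (\<i> * of_int (- n) * e x) = v x * e x - \<i> * of_int n * (F x * e x)" for x
    by simp
  note m' = m(2)[unfolded this]
  have "0 = (LINT x|circ. v x * e x - \<i> * of_int n * (F x * e x))"
    unfolding m' using per \<open>e (2 * pi) = e 0\<close> by simp
  also have "\<dots> = (LINT x|circ. v x * e x) - \<i> * of_int n * (LINT x|circ. F x * e x)"
  proof (subst Bochner_Integration.integral_diff)
    show "integrable circ (\<lambda>x. v x * e x)"
      unfolding e_def by (rule integrable_mult_cis[OF ac_deriv_on_circ(1)[OF F]])
    have "integrable circ (\<lambda>x. F x * e x)"
      unfolding e_def
      by (rule integrable_mult_cis[OF integrable_circ_continuous[OF ac_deriv_on_continuous[OF F]]])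
    then show "integrable circ (\<lambda>x. \<i> * of_int n * (F x * e x))" by simp
  qed simp
  finally have "(LINT x|circ. v x * e x) = \<i> * of_int n * (LINT x|circ. F x * e x)" by simp
  then show ?thesis by (simp add: fc_def e_def)
qed

section \<open>Traces of holomorphic functions on the strip\<close>

text \<open>\<open>strip_trace D F\<close> says that \<open>F\<close> has a holomorphic extension to the strip \<open>-D < Im z < 0\<close>
  which is real on the line \<open>Im z = -D\<close>: the numbers \<open>fc F n * exp (n * D)\<close> are the Fourier
  coefficients of the extension on that line.\<close>

definition strip_trace :: "real \<Rightarrow> (real \<Rightarrow> complex) \<Rightarrow> bool" where
  "strip_trace D F \<longleftrightarrow>
     (\<forall>n. fc F (- n) * of_real (exp (- of_int n * D)) = cnj (fc F n * of_real (exp (of_int n * D))))"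

lemma strip_trace_add:
  "strip_trace D F \<Longrightarrow> strip_trace D G \<Longrightarrow> integrable circ F \<Longrightarrow> integrable circ G \<Longrightarrow>
   strip_trace D (\<lambda>x. F x + G x)"
  by (simp add: strip_trace_def fc_add distrib_right)

lemma strip_trace_of_real_mult: "strip_trace D F \<Longrightarrow> strip_trace D (\<lambda>x. of_real c * F x)"
  by (simp add: strip_trace_def fc_cmult mult.assoc)

lemma fc_const: "fc (\<lambda>x. c) n = (if n = 0 then c else 0)"
  using fc_cis[of 0 n] fc_cmult[of c "\<lambda>x. 1" n] by simp

lemma strip_trace_const: "strip_trace D (\<lambda>x. of_real c)"
  by (simp add: strip_trace_def fc_const)

text \<open>On the bottom line too the coefficients of a product are a convolution, and convolution
  preserves the symmetry that expresses reality. Truncating \<open>F\<close> makes the convolution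
  finite; for fixed \<open>n\<close> the weight \<open>exp (n * D)\<close> is a constant, so the
  symmetry survives the L2 limit.\<close>

lemma strip_trace_mult:
  assumes F: "strip_trace D F" "sq_integrable circ F" and G: "strip_trace D G" "sq_integrable circ G"
  shows "strip_trace D (\<lambda>x. F x * G x)"
proof -
  define T where "T N = trig {- int N..int N} (fc F)" for N
  have T: "sq_integrable circ (T N)" for N
    unfolding T_def by (intro sq_integrable_circ_continuous continuous_intros)
  have lim: "(\<lambda>N. fc (\<lambda>x. T N x * G x) n) \<longlonglongrightarrow> fc (\<lambda>x. F x * G x) n" for n
  proof -
    note [measurable] = sq_integrable_measurable[OF G(2)]
    have [measurable]: "(\<lambda>x. cis (- (of_int n * x))) \<in> borel_measurable circ"
      by (intro borel_measurable_circ_continuous continuous_on_cis_linear')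
    have "sq_integrable circ (\<lambda>x. G x * cis (- (of_int n * x)))"
      by (rule sq_integrable_bound[OF G(2), where C=1]) (auto simp: norm_mult)
    from L2_tendsto_integral_mult[OF T F(2) this trig_tendsto_L2[OF F(2), folded T_def]]
    show ?thesis unfolding fc_def by (intro tendsto_intros) (simp add: mult.assoc)
  qed
  have sym: "fc (\<lambda>x. T N x * G x) (- n) * of_real (exp (- of_int n * D))
      = cnj (fc (\<lambda>x. T N x * G x) n * of_real (exp (of_int n * D)))" for n N
  proof -
    define E where "E H j = fc H j * of_real (exp (of_int j * D))" for H j
    have E: "E (\<lambda>x. T N x * G x) n = (\<Sum>j\<in>{- int N..int N}. E F j * E G (n - j))" for n
    proof -
      have ex: "exp (of_int n * D) = exp (of_int j * D) * exp (of_int (n - j) * D)" for j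
        by (simp add: algebra_simps flip: exp_add)
      have "fc F j * fc G (n - j) * of_real (exp (of_int n * D)) = E F j * E G (n - j)" for j
        unfolding E_def ex[of j] of_real_mult by (simp only: mult_ac)
      then show ?thesis
        unfolding T_def E_def[of "\<lambda>x. trig {- int N..int N} (fc F) x * G x"]
          fc_trig_mult[OF circ.sq_integrable_imp_integrable[OF G(2)]] sum_distrib_right
        by simp
    qed
    have EF: "E F (- j) = cnj (E F j)" and EG: "E G (- j) = cnj (E G j)" for j
      using F(1) G(1) by (simp_all add: strip_trace_def E_def)
    \<comment> \<open>The truncation range is symmetric, hence invariant under negation of
      \<open>j\<close>.\<close>
    have "E (\<lambda>x. T N x * G x) (- n) = (\<Sum>j\<in>{- int N..int N}. E F (- j) * E G (- n - (- j)))"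
      unfolding E by (rule sum.reindex_bij_witness[of _ uminus uminus]) auto
    also have "\<dots> = (\<Sum>j\<in>{- int N..int N}. cnj (E F j * E G (n - j)))"
      using EG[of "n - j" for j] by (intro sum.cong refl) (simp add: EF)
    also have "\<dots> = cnj (E (\<lambda>x. T N x * G x) n)" by (simp add: E)
    finally show ?thesis by (simp add: E_def)
  qed
  show ?thesis
    unfolding strip_trace_def
  proof
    fix n
    have "(\<lambda>N. fc (\<lambda>x. T N x * G x) (- n) * of_real (exp (- of_int n * D)))
        \<longlonglongrightarrow> fc (\<lambda>x. F x * G x) (- n) * of_real (exp (- of_int n * D))"
      by (intro tendsto_intros lim)
    moreover have "(\<lambda>N. cnj (fc (\<lambda>x. T N x * G x) n * of_real (exp (of_int n * D))))
        \<longlonglongrightarrow> cnj (fc (\<lambda>x. F x * G x) n * of_real (exp (of_int n * D)))"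
      by (intro tendsto_intros tendsto_cnj lim)
    ultimately show "fc (\<lambda>x. F x * G x) (- n) * of_real (exp (- of_int n * D))
        = cnj (fc (\<lambda>x. F x * G x) n * of_real (exp (of_int n * D)))"
      unfolding sym by (rule LIMSEQ_unique)
  qed
qed

text \<open>Differentiation multiplies coefficients by \<open>\<i> * n\<close>, and this factor at
  \<open>- n\<close> is the complex conjugate of the one at \<open>n\<close>.\<close>

lemma strip_trace_deriv:
  assumes "strip_trace D F" "ac_deriv_on 0 (2 * pi) F v" "F (2 * pi) = F 0"
  shows "strip_trace D v"
  using assms(1) by (simp add: strip_trace_def fc_ac_deriv[OF assms(2,3)])

text \<open>At \<open>n = 0\<close> the defining symmetry says that the mean is real.\<close>

lemma strip_trace_integral_Im:
  assumes "strip_trace D F" "integrable circ F"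
  shows "(LINT x|circ. Im (F x)) = 0"
proof -
  have "fc F 0 = cnj (fc F 0)" using assms(1) by (auto simp: strip_trace_def dest: spec[of _ 0])
  then have "Im (fc F 0) = 0" by (simp add: complex_eq_iff)
  moreover have "fc F 0 = (LINT x|circ. F x) / of_real (2 * pi)" by (simp add: fc_def)
  ultimately have "Im (LINT x|circ. F x) = 0" by (simp add: Im_divide_of_real)
  then show ?thesis using assms(2) by simp
qed

text \<open>Real and imaginary part have half the sum and half the difference, over
  \<open>\<i>\<close>, of \<open>fc F n\<close> and \<open>cnj (fc F (- n))\<close> as coefficients.
  The symmetry makes the second number \<open>exp (2 * n * D)\<close> times the first, which is the
  origin of \<open>coth\<close>.\<close>

lemma strip_trace_Re_Im:
  assumes F: "strip_trace D F" "integrable circ F" and D: "D > 0" and n: "n \<noteq> 0"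
  shows "fc (\<lambda>x. of_real (Re (F x))) n
    = - \<i> * of_real (coth (of_int n * D)) * fc (\<lambda>x. of_real (Im (F x))) n"
proof -
  define \<alpha> where "\<alpha> = fc F n"
  define \<beta> where "\<beta> = cnj (fc F (- n))"
  have iF: "integrable circ (\<lambda>x. cnj (F x))" using F(2) by simp
  have "of_real (Re z) = (1/2) * (z + cnj z)" "of_real (Im z) = (- \<i> / 2) * (z - cnj z)" for z
    by (simp_all add: complex_eq_iff)
  then have re: "fc (\<lambda>x. of_real (Re (F x))) n = (1/2) * (\<alpha> + \<beta>)"
    and im: "fc (\<lambda>x. of_real (Im (F x))) n = (- \<i> / 2) * (\<alpha> - \<beta>)"
    by (simp_all only: fc_cmult fc_add[OF F(2) iF] fc_diff[OF F(2) iF] fc_cnj \<alpha>_def \<beta>_def)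
  define s c where "s = sinh (of_int n * D)" and "c = cosh (of_int n * D)"
  have s: "s \<noteq> 0" using D n by (simp add: s_def)
  have "cnj (fc F (- n) * of_real (exp (- of_int n * D))) = cnj (cnj (fc F n * of_real (exp (of_int n * D))))"
    using F(1) by (simp add: strip_trace_def)
  then have "\<beta> * of_real (exp (- of_int n * D)) = \<alpha> * of_real (exp (of_int n * D))"
    by (simp add: \<alpha>_def \<beta>_def)
  moreover have "exp (of_int n * D) = c + s" "exp (- of_int n * D) = c - s"
    by (simp_all add: c_def s_def cosh_field_def sinh_field_def field_simps)
  ultimately have "\<beta> * (of_real c - of_real s) = \<alpha> * (of_real c + of_real s)" by simp
  then have "(\<alpha> + \<beta>) * of_real s = - (of_real c * (\<alpha> - \<beta>))" by (simp add: algebra_simps)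
  then have "\<alpha> + \<beta> = - (of_real c / of_real s) * (\<alpha> - \<beta>)" using s by (simp add: field_simps)
  moreover have "- \<i> * C * ((- \<i> / 2) * X) = (1/2) * (- C * X)" for C X
    by (simp add: complex_eq_iff field_simps)
  ultimately show ?thesis
    unfolding re im coth_def by (simp only: of_real_divide flip: s_def c_def)
qed

section \<open>The conjugation operator\<close>

lemma L2_perD:
  assumes "f \<in> L2_per"
  shows "f (x + 2 * pi) = f x" "f \<in> borel_measurable borel" "sq_integrable circ f"
    "sq_integrable circ (\<lambda>x. complex_of_real (f x))"
proof -
  have f: "periodic2pi f" "f \<in> borel_measurable borel" "integrable circ (\<lambda>x. (f x)\<^sup>2)"
    using assms by (simp_all add: L2_per_def set_integrable_circ)
  show "f (x + 2 * pi) = f x" using f(1) by (simp add: periodic2pi_def)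
  show "f \<in> borel_measurable borel" by (fact f(2))
  note [measurable] = borel_measurable_circ[OF f(2)]
  show "sq_integrable circ f" "sq_integrable circ (\<lambda>x. complex_of_real (f x))"
    unfolding sq_integrable_def using f(3) by simp_all
qed

lemma L2_perI:
  assumes "\<And>x. f (x + 2 * pi) = f x" "f \<in> borel_measurable borel" "sq_integrable circ f"
  shows "f \<in> L2_per"
  using assms by (simp add: L2_per_def periodic2pi_def sq_integrable_def set_integrable_circ)

lemma L2_per_continuous:
  assumes "\<And>x. f (x + 2 * pi) = f x" "continuous_on UNIV f"
  shows "f \<in> L2_per"
  using assms by (intro L2_perI borel_measurable_continuous_onI sq_integrable_circ_continuous)
    (auto intro: continuous_on_subset)

lemma is_conjugate_iff_fc:
  "is_conjugate D f \<phi> \<longleftrightarrow> \<phi> \<in> L2_per \<and> fc (\<lambda>x. of_real (\<phi> x)) 0 = 0 \<and>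
     (\<forall>n. n \<noteq> 0 \<longrightarrow> fc (\<lambda>x. of_real (\<phi> x)) n
        = - \<i> * of_real (coth (of_int n * D)) * fc (\<lambda>x. of_real (f x)) n)"
  by (simp add: is_conjugate_def fourier_coeff_eq_fc)

lemma coth_minus: "coth (- x) = - coth x"
  by (simp add: coth_def)

text \<open>\<open>coth\<close> is odd, and positive and decreasing on the positive axis. The bound
  makes the multiplier bounded on L2.\<close>

lemma abs_coth_le:
  fixes D :: real
  assumes D: "D > 0" and n: "n \<noteq> 0"
  shows "\<bar>coth (of_int n * D)\<bar> \<le> coth D"
proof -
  have pos: "coth x \<le> coth D" "coth x > 0" if "D \<le> x" for x
  proof -
    have "sinh (x - D) \<ge> 0" using that by simp
    then have "cosh x * sinh D \<le> cosh D * sinh x" by (simp add: sinh_diff mult.commute)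
    then show "coth x \<le> coth D" using that D by (simp add: coth_def field_simps)
    show "coth x > 0" using that D by (simp add: coth_def)
  qed
  have le: "D \<le> \<bar>of_int n\<bar> * D"
    using n D by (intro mult_right_mono[of 1 "\<bar>of_int n\<bar>" D, simplified]) auto
  show ?thesis
  proof (cases "n > 0")
    case True
    then show ?thesis using pos[OF le] by simp
  next
    case False
    then show ?thesis using pos[OF le] by (simp add: coth_minus)
  qed
qed

text \<open>Riesz-Fischer gives a complex function for the prescribed coefficients; these satisfy
  \<open>c (- n) = cnj (c n)\<close>, so its real part has the same ones.\<close>

lemma is_conjugate_exists:
  assumes f: "f \<in> L2_per" and D: "D > 0"
  shows "\<exists>\<phi>. is_conjugate D f \<phi>"
proof -
  define a where "a = fc (\<lambda>x. of_real (f x))"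
  define c where "c n = (if n = 0 then 0 else - \<i> * of_real (coth (of_int n * D)) * a n)" for n
  have cle: "cmod (c n) \<le> coth D * cmod (a n)" for n
  proof (cases "n = 0")
    case True
    then show ?thesis using D by (simp add: c_def coth_def)
  next
    case False
    then show ?thesis using abs_coth_le[OF D False] by (simp add: c_def norm_mult mult_right_mono)
  qed
  have "(\<Sum>n\<in>S. (cmod (c n))\<^sup>2) \<le> (coth D)\<^sup>2 * ((LINT x|circ. (cmod (of_real (f x)))\<^sup>2) / (2 * pi))"
    if S: "finite S" for S
  proof -
    have "(\<Sum>n\<in>S. (cmod (c n))\<^sup>2) \<le> (\<Sum>n\<in>S. (coth D)\<^sup>2 * (cmod (a n))\<^sup>2)"
      by (intro sum_mono) (use cle in \<open>auto simp flip: power_mult_distrib intro!: power_mono\<close>)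
    also have "\<dots> = (coth D)\<^sup>2 * (\<Sum>n\<in>S. (cmod (a n))\<^sup>2)" by (simp add: sum_distrib_left)
    also have "\<dots> \<le> (coth D)\<^sup>2 * ((LINT x|circ. (cmod (of_real (f x)))\<^sup>2) / (2 * pi))"
      using Bessel_inequality[OF L2_perD(4)[OF f] S]
      by (intro mult_left_mono) (auto simp: a_def field_simps)
    finally show ?thesis .
  qed
  from Riesz_Fischer[OF this] obtain F where F: "sq_integrable circ F" "\<And>n. fc F n = c n" by blast
  have iF: "integrable circ F" "integrable circ (\<lambda>x. cnj (F x))"
    using circ.sq_integrable_imp_integrable[OF F(1)] by auto
  have a_cnj: "a (- n) = cnj (a n)" for n
    using fc_cnj[of "\<lambda>x. of_real (f x)" "- n"] by (simp add: a_def)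
  have c_cnj: "c (- n) = cnj (c n)" for n
    by (simp add: c_def a_cnj coth_minus)
  \<comment> \<open>\<open>F\<close> is measurable on the closed interval only; a Borel function on
    the line is needed before extending periodically.\<close>
  obtain H where H: "H \<in> borel_measurable borel" "\<And>x. x \<in> {0..2 * pi} \<Longrightarrow> H x = Re (F x)"
  proof
    note [measurable] = sq_integrable_measurable[OF F(1)]
    have "(\<lambda>x. Re (F x)) \<in> borel_measurable circ" by measurable
    then show "(\<lambda>x. indicator {0..2 * pi} x *\<^sub>R Re (F x)) \<in> borel_measurable borel"
      by (simp add: borel_measurable_restrict_space_iff)
  qed simp
  define \<phi> where "\<phi> = per_ext H"
  have \<phi>_borel: "\<phi> \<in> borel_measurable borel" unfolding \<phi>_def using H(1) by measurable
  have AE: "AE x in circ. \<phi> x = Re (F x)"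
    using AE_circ_not_endpoint AE_space
    by eventually_elim (auto simp: \<phi>_def per_ext_eq H(2))
  have "sq_integrable circ \<phi>"
    by (rule sq_integrable_bound[OF F(1), where C=1])
       (use AE \<phi>_borel in \<open>auto intro!: borel_measurable_circ elim!: eventually_mono simp: abs_Re_le_cmod\<close>)
  then have "\<phi> \<in> L2_per"
    using \<phi>_borel by (intro L2_perI) (auto simp: \<phi>_def per_ext_periodic)
  moreover have "fc (\<lambda>x. of_real (\<phi> x)) n = c n" for n
  proof -
    note [measurable] = sq_integrable_measurable[OF F(1)] borel_measurable_circ[OF \<phi>_borel]
      borel_measurable_integrable[OF iF(2)]
    have "fc (\<lambda>x. of_real (\<phi> x)) n = fc (\<lambda>x. (1/2) * (F x + cnj (F x))) n"
    proof (rule fc_cong_AE)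
      show "AE x in circ. of_real (\<phi> x) = (1/2) * (F x + cnj (F x))"
        using AE by eventually_elim (simp add: complex_eq_iff)
    qed measurable
    also have "\<dots> = c n"
      by (simp only: fc_cmult fc_add[OF iF] fc_cnj F(2) c_cnj) simp
    finally show ?thesis .
  qed
  ultimately have "is_conjugate D f \<phi>"
    by (simp add: is_conjugate_iff_fc c_def a_def)
  then show ?thesis by blast
qed

lemma is_conjugate_AE_unique:
  assumes "is_conjugate D f \<phi>" "is_conjugate D f \<psi>"
  shows "AE x in circ. \<phi> x = \<psi> x"
proof -
  have eq: "fc (\<lambda>x. of_real (\<phi> x)) n = fc (\<lambda>x. of_real (\<psi> x)) n" for n
    using assms by (cases "n = 0") (auto simp: is_conjugate_iff_fc)
  have "\<phi> \<in> L2_per" "\<psi> \<in> L2_per" using assms by (auto simp: is_conjugate_def)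
  from fc_eq_imp_AE_eq[OF circ.sq_integrable_imp_integrable circ.sq_integrable_imp_integrable eq]
  show ?thesis using L2_perD(4)[OF \<open>\<phi> \<in> L2_per\<close>] L2_perD(4)[OF \<open>\<psi> \<in> L2_per\<close>] by simp
qed

text \<open>The choice in \<open>conj_op\<close> has a candidate: a continuous conjugate if there is
  one, and \<open>\<psi>\<close> otherwise.\<close>

lemma conj_op_properties:
  assumes "is_conjugate D f \<psi>"
  shows "is_conjugate D f (conj_op D f)" "AE x in circ. conj_op D f x = \<psi> x"
    "continuous_on UNIV \<psi> \<Longrightarrow> continuous_on UNIV (conj_op D f)"
proof -
  have "\<exists>\<phi>. is_conjugate D f \<phi> \<and>
     ((\<exists>\<psi>. is_conjugate D f \<psi> \<and> continuous_on UNIV \<psi>) \<longrightarrow> continuous_on UNIV \<phi>)"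
    using assms by blast
  from someI_ex[OF this, folded conj_op_def]
  show 1: "is_conjugate D f (conj_op D f)"
    and "continuous_on UNIV \<psi> \<Longrightarrow> continuous_on UNIV (conj_op D f)"
    using assms by blast+
  show "AE x in circ. conj_op D f x = \<psi> x" by (rule is_conjugate_AE_unique[OF 1 assms])
qed

lemma continuous_AE_circ_eq:
  fixes f g :: "real \<Rightarrow> real"
  assumes f: "continuous_on UNIV f" and g: "continuous_on UNIV g" and ae: "AE x in circ. f x = g x"
    and x: "0 \<le> x" "x < 2 * pi"
  shows "f x = g x"
proof (rule ccontr)
  assume ne: "f x \<noteq> g x"
  have "open {y. f y \<noteq> g y}" by (rule open_Collect_neq[OF f g])
  then obtain e where e: "e > 0" "ball x e \<subseteq> {y. f y \<noteq> g y}"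
    using ne open_contains_ball by blast
  \<comment> \<open>\<open>x < 2 * pi\<close> leaves room to the right of \<open>x\<close>, so the
    set of disagreement contains an interval of positive length within the circle.\<close>
  define b where "b = min (x + e / 2) (2 * pi)"
  have b: "x < b" using e x by (simp add: b_def)
  have sub: "{x..b} \<subseteq> {y. y \<in> {0..2 * pi} \<and> f y \<noteq> g y}"
  proof
    fix y assume y: "y \<in> {x..b}"
    then have "y \<in> ball x e" using e by (auto simp: b_def dist_real_def)
    then show "y \<in> {y. y \<in> {0..2 * pi} \<and> f y \<noteq> g y}" using e y x by (auto simp: b_def)
  qed
  have "AE y in lborel. y \<in> {0..2 * pi} \<longrightarrow> f y = g y"
    using ae by (subst (asm) AE_restrict_space_iff) auto
  then have "AE y in lborel. y \<notin> {x..b}" using sub by (auto elim!: eventually_mono)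
  then have "emeasure lborel {x..b} = 0" by (subst (asm) AE_iff_measurable[of "{x..b}"]) auto
  then show False using b by simp
qed

lemma conj_op_eq_continuous:
  assumes \<psi>: "is_conjugate D f \<psi>" "continuous_on UNIV \<psi>"
  shows "conj_op D f = \<psi>"
proof
  fix x
  note c = conj_op_properties[OF \<psi>(1)]
  have "conj_op D f \<in> L2_per" "\<psi> \<in> L2_per" using c(1) \<psi>(1) by (auto simp: is_conjugate_def)
  then show "conj_op D f x = \<psi> x"
    by (rule periodic_eqI_circ[OF L2_perD(1) L2_perD(1)
          continuous_AE_circ_eq[OF c(3)[OF \<psi>(2)] \<psi>(2) c(2)]])
qed

lemma is_conjugate_conj_op:
  "f \<in> L2_per \<Longrightarrow> D > 0 \<Longrightarrow> is_conjugate D f (conj_op D f)"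
  using is_conjugate_exists conj_op_properties(1) by blast

text \<open>The weight \<open>exp (n * D)\<close> turns the multiplier
  \<open>\<i> - \<i> * coth (n * D)\<close> into \<open>- \<i> / sinh (n * D)\<close>. Its complex
  conjugate is its value at \<open>- n\<close>, just as for the coefficients of the real function
  \<open>f\<close>.\<close>

lemma strip_trace_is_conjugate:
  assumes c: "is_conjugate D f \<phi>" and f: "f \<in> L2_per" "fc (\<lambda>x. of_real (f x)) 0 = 0" and D: "D > 0"
  shows "strip_trace D (\<lambda>x. Complex (\<phi> x) (f x))"
proof -
  define a where "a = fc (\<lambda>x. of_real (f x))"
  have \<phi>: "\<phi> \<in> L2_per" using c by (simp add: is_conjugate_def)
  have i: "integrable circ (\<lambda>x. complex_of_real (\<phi> x))" "integrable circ (\<lambda>x. complex_of_real (f x))"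
    using L2_perD(4)[OF \<phi>] L2_perD(4)[OF f(1)] by (auto dest: circ.sq_integrable_imp_integrable)
  then have i': "integrable circ (\<lambda>x. \<i> * complex_of_real (f x))" by simp
  have eq: "Complex (\<phi> x) (f x) = of_real (\<phi> x) + \<i> * of_real (f x)" for x
    by (simp add: complex_eq_iff)
  have fcF: "fc (\<lambda>x. Complex (\<phi> x) (f x)) n = fc (\<lambda>x. of_real (\<phi> x)) n + \<i> * a n" for n
    unfolding eq a_def by (simp only: fc_add[OF i(1) i'] fc_cmult)
  have a_cnj: "a (- n) = cnj (a n)" for n
    using fc_cnj[of "\<lambda>x. of_real (f x)" "- n"] by (simp add: a_def)
  have *: "fc (\<lambda>x. Complex (\<phi> x) (f x)) n * of_real (exp (of_int n * D))
      = - \<i> / of_real (sinh (of_int n * D)) * a n" if n: "n \<noteq> 0" for n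
  proof -
    define s c where "s = sinh (of_int n * D)" and "c = cosh (of_int n * D)"
    have s: "s \<noteq> 0" using D n by (simp add: s_def)
    have ex: "exp (of_int n * D) = c + s"
      by (simp add: c_def s_def cosh_field_def sinh_field_def field_simps)
    have "c * c - s * s = 1"
      using cosh_square_eq[of "of_int n * D"] by (simp add: c_def s_def power2_eq_square)
    then have cs: "of_real c * of_real c - of_real s * of_real s = (1 :: complex)"
      by (metis of_real_1 of_real_diff of_real_mult)
    have "fc (\<lambda>x. Complex (\<phi> x) (f x)) n = - \<i> * of_real (c / s) * a n + \<i> * a n"
      using assms(1) n by (simp add: fcF is_conjugate_iff_fc coth_def s_def c_def a_def)
    also have "\<dots> * of_real (exp (of_int n * D))
        = - \<i> * a n * (of_real c * of_real c - of_real s * of_real s) / of_real s"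
      unfolding ex using s by (simp add: field_simps)
    finally show ?thesis unfolding cs unfolding s_def by (simp add: mult_ac)
  qed
  show ?thesis
    unfolding strip_trace_def
  proof
    fix n
    show "fc (\<lambda>x. Complex (\<phi> x) (f x)) (- n) * of_real (exp (- of_int n * D))
      = cnj (fc (\<lambda>x. Complex (\<phi> x) (f x)) n * of_real (exp (of_int n * D)))"
    proof (cases "n = 0")
      case True
      then show ?thesis using c f(2) by (simp add: fcF is_conjugate_iff_fc a_def)
    next
      case False
      then show ?thesis using *[of n] *[of "- n"] by (simp add: a_cnj)
    qed
  qed
qed

text \<open>The converse passage. The mean \<open>c\<close> of the real part is removed because
  conjugates have mean zero.\<close>

lemma is_conjugate_strip_trace:
  assumes F: "strip_trace D F" "integrable circ F" and D: "D > 0"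
    and L2: "(\<lambda>x. Re (F x) - c) \<in> L2_per" and mean: "(LINT x|circ. Re (F x)) = 2 * pi * c"
  shows "is_conjugate D (\<lambda>x. Im (F x)) (\<lambda>x. Re (F x) - c)"
proof -
  have iR: "integrable circ (\<lambda>x. complex_of_real (Re (F x)))" using F(2) by simp
  have eq: "fc (\<lambda>x. of_real (Re (F x) - c)) n
      = fc (\<lambda>x. of_real (Re (F x))) n - (if n = 0 then of_real c else 0)" for n
    using fc_diff[OF iR, of "\<lambda>x. of_real c" n] by (simp add: fc_const)
  have "(LINT x|circ. complex_of_real (Re (F x))) = of_real (2 * pi * c)"
    by (simp only: integral_complex_of_real mean)
  then have "fc (\<lambda>x. of_real (Re (F x))) 0 = of_real c" by (simp add: fc_def)
  then show ?thesis
    unfolding is_conjugate_iff_fc using L2 strip_trace_Re_Im[OF F D] by (simp add: eq del: of_real_diff)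
qed

section \<open>Weak derivatives and conjugates of H1 functions\<close>

lemma has_weak_deriv_ac:
  assumes "has_weak_deriv f v"
  shows "ac_deriv_on 0 (2 * pi) f v"
  unfolding ac_deriv_on_def has_bochner_integral_iff
proof (intro allI impI conjI)
  fix a b :: real assume ab: "0 \<le> a" "a \<le> b" "b \<le> 2 * pi"
  have "v \<in> L2_per" using assms by (simp add: has_weak_deriv_def)
  then have "integrable circ v" using L2_perD(3) circ.sq_integrable_imp_integrable by blast
  then have "integrable lborel (\<lambda>t. indicator {a..b} t *\<^sub>R (indicator {0..2 * pi} t *\<^sub>R v t))"
    by (intro integrable_mult_indicator[of "{a..b}" lborel "\<lambda>t. indicator {0..2 * pi} t *\<^sub>R v t"])
       (auto simp: integrable_restrict_space)
  also have "(\<lambda>t. indicator {a..b} t *\<^sub>R (indicator {0..2 * pi} t *\<^sub>R v t)) = (\<lambda>t. indicator {a..b} t *\<^sub>R v t)"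
    using ab by (auto simp: indicator_def)
  finally show "integrable lborel (\<lambda>t. indicator {a..b} t *\<^sub>R v t)" .
  show "(LINT t|lborel. indicator {a..b} t *\<^sub>R v t) = f b - f a"
    using assms ab by (simp add: has_weak_deriv_def set_lebesgue_integral_def)
qed

lemma has_weak_derivI:
  assumes "v \<in> L2_per" "\<And>x. f (x + 2 * pi) = f x" "ac_deriv_on 0 (2 * pi) f v"
  shows "has_weak_deriv f v"
  unfolding has_weak_deriv_def
proof (intro conjI allI impI)
  fix a b :: real assume "a \<le> b"
  moreover have "ac_deriv_on a b f v"
    by (rule ac_deriv_on_periodic[OF assms(3,2) L2_perD(1)[OF assms(1)]])
  ultimately show "f b - f a = (LINT t:{a..b}|lborel. v t)"
    by (auto dest!: ac_deriv_onD[of a b f v a b] simp: has_bochner_integral_iff set_lebesgue_integral_def)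
qed fact

lemma continuous_on_UNIV_periodic_ac:
  assumes "\<And>x. F (x + 2 * pi) = F x" "\<And>x. v (x + 2 * pi) = v x" "ac_deriv_on 0 (2 * pi) F v"
  shows "continuous_on UNIV F"
proof -
  have "continuous_on {- real n<..<real n} F" for n
    by (rule continuous_on_subset[OF ac_deriv_on_continuous[OF ac_deriv_on_periodic[OF assms(3,1,2)],
            of "- real n" "real n"]]) auto
  then have "continuous_on (\<Union>n. {- real n<..<real n}) F"
    by (intro continuous_on_open_UN) auto
  moreover have "(\<Union>n. {- real n<..<real n}) = UNIV"
  proof -
    have "x \<in> (\<Union>n. {- real n<..<real n})" for x
    proof -
      obtain n where "\<bar>x\<bar> < real n" using reals_Archimedean2 by blast
      then show ?thesis by (intro UN_I[of n]) auto
    qed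
    then show ?thesis by blast
  qed
  ultimately show ?thesis by simp
qed

text \<open>The conjugate \<open>A\<close> of \<open>v\<close> has mean zero, so its antiderivative
  is periodic. Normalised to mean zero, this has the coefficients of a conjugate of
  \<open>u\<close>, and being continuous it is the representative that \<open>conj_op\<close>
  picks.\<close>

lemma conj_op_ac_deriv:
  assumes u: "has_weak_deriv u v" "\<And>x. u (x + 2 * pi) = u x" and D: "D > 0"
  shows "ac_deriv_on 0 (2 * pi) (conj_op D u) (conj_op D v)"
    "continuous_on UNIV (conj_op D u)" "is_conjugate D u (conj_op D u)"
proof -
  have v: "v \<in> L2_per" using u by (simp add: has_weak_deriv_def)
  define A where "A = conj_op D v"
  have A: "is_conjugate D v A" unfolding A_def by (rule is_conjugate_conj_op[OF v D])
  then have AL: "A \<in> L2_per" by (simp add: is_conjugate_def)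
  have iA: "integrable circ A" using L2_perD(3)[OF AL] by (rule circ.sq_integrable_imp_integrable)
  have "fc (\<lambda>x. of_real (A x)) 0 = 0" using A by (simp add: is_conjugate_iff_fc)
  then have A0: "(LINT x|circ. A x) = 0" by (simp add: fc_def)
  define \<psi>0 where "\<psi>0 x = (\<integral>t. indicator {0..x} t *\<^sub>R A t \<partial>lborel)" for x
  have \<psi>0: "ac_deriv_on 0 (2 * pi) \<psi>0 A" unfolding \<psi>0_def by (rule ac_deriv_on_indefinite[OF iA])
  have per0: "\<psi>0 (2 * pi) = \<psi>0 0" using ac_deriv_on_circ(2)[OF \<psi>0] A0 by simp
  define \<psi>1 where "\<psi>1 = per_ext \<psi>0"
  define c where "c = (LINT x|circ. \<psi>1 x) / (2 * pi)"
  define \<psi> where "\<psi> x = \<psi>1 x - c" for x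
  have \<psi>: "ac_deriv_on 0 (2 * pi) \<psi> A"
    using \<psi>0 by (simp add: ac_deriv_on_def \<psi>_def \<psi>1_def per_ext_eq' per0)
  have per: "\<psi> (x + 2 * pi) = \<psi> x" for x by (simp add: \<psi>_def \<psi>1_def per_ext_periodic)
  have cont: "continuous_on UNIV \<psi>"
    by (rule continuous_on_UNIV_periodic_ac[OF per L2_perD(1)[OF AL] \<psi>])
  have i\<psi>: "integrable circ \<psi>" by (intro integrable_circ_continuous continuous_on_subset[OF cont]) auto
  have "(LINT x|circ. \<psi> x) = 0"
  proof -
    have "(\<lambda>x. \<psi>1 x) = (\<lambda>x. \<psi> x + c)" by (simp add: \<psi>_def)
    then have "(LINT x|circ. \<psi>1 x) = (LINT x|circ. \<psi> x) + c * (2 * pi)" using i\<psi> by simp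
    then show ?thesis by (simp add: c_def)
  qed
  then have fc0: "fc (\<lambda>x. of_real (\<psi> x)) 0 = 0" by (simp add: fc_def)
  have fc_\<psi>: "fc (\<lambda>x. of_real (A x)) n = \<i> * of_int n * fc (\<lambda>x. of_real (\<psi> x)) n" for n
    by (rule fc_ac_deriv[OF ac_deriv_on_bounded_linear[OF bounded_linear_of_real \<psi>]])
       (use per[of 0] in simp)
  have fc_u: "fc (\<lambda>x. of_real (v x)) n = \<i> * of_int n * fc (\<lambda>x. of_real (u x)) n" for n
    by (rule fc_ac_deriv[OF ac_deriv_on_bounded_linear[OF bounded_linear_of_real has_weak_deriv_ac[OF u(1)]]])
       (use u(2)[of 0] in simp)
  have "fc (\<lambda>x. of_real (\<psi> x)) n = - \<i> * of_real (coth (of_int n * D)) * fc (\<lambda>x. of_real (u x)) n"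
    if n: "n \<noteq> 0" for n
  proof -
    have "\<i> * of_int n * fc (\<lambda>x. of_real (\<psi> x)) n
        = \<i> * of_int n * (- \<i> * of_real (coth (of_int n * D)) * fc (\<lambda>x. of_real (u x)) n)"
      using A n by (simp add: is_conjugate_iff_fc fc_u flip: fc_\<psi>)
    then show ?thesis using n by (subst (asm) mult_left_cancel) auto
  qed
  then have conj: "is_conjugate D u \<psi>"
    using L2_per_continuous[OF per cont] fc0 by (simp add: is_conjugate_iff_fc)
  have eq: "conj_op D u = \<psi>" by (rule conj_op_eq_continuous[OF conj cont])
  show "ac_deriv_on 0 (2 * pi) (conj_op D u) (conj_op D v)"
    using \<psi> by (simp add: eq A_def)
  show "continuous_on UNIV (conj_op D u)" using cont by (simp add: eq)
  show "is_conjugate D u (conj_op D u)" using conj by (simp add: eq)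
qed

section \<open>The second variation\<close>

lemma int2pi_circ: "int2pi f = (LINT x|circ. f x)"
  by (simp add: int2pi_def set_integral_circ)

lemma sq_integrable_mult_continuous:
  fixes f g :: "real \<Rightarrow> 'b::{euclidean_space, real_normed_algebra}"
  assumes "sq_integrable circ f" "continuous_on {0..2 * pi} g"
  shows "sq_integrable circ (\<lambda>x. f x * g x)"
proof -
  have "compact (g ` {0..2 * pi})"
    using assms by (intro compact_continuous_image) auto
  then obtain K where K: "\<And>x. x \<in> {0..2 * pi} \<Longrightarrow> norm (g x) \<le> K"
    using compact_imp_bounded bounded_iff by (metis imageI)
  note [measurable] = sq_integrable_measurable[OF assms(1)] borel_measurable_circ_continuous[OF assms(2)]
  show ?thesis
  proof (rule sq_integrable_bound[OF assms(1), where C=K])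
    show "AE x in circ. norm (f x * g x) \<le> K * norm (f x)"
    proof (rule AE_I2)
      fix x assume "x \<in> space circ"
      then have "norm (f x) * norm (g x) \<le> norm (f x) * K" using K by (intro mult_left_mono) auto
      then show "norm (f x * g x) \<le> K * norm (f x)"
        using norm_mult_ineq[of "f x" "g x"] by (simp add: mult.commute)
    qed
  qed measurable
qed

lemma L2_per_add: "f \<in> L2_per \<Longrightarrow> f' \<in> L2_per \<Longrightarrow> (\<lambda>x. f x + f' x) \<in> L2_per"
  by (intro L2_perI sq_integrable_add borel_measurable_add) (auto simp: L2_perD)

lemma L2_per_mult_continuous:
  assumes "f \<in> L2_per" "\<And>x. c (x + 2 * pi) = c x" "continuous_on UNIV c"
  shows "(\<lambda>x. f x * c x) \<in> L2_per"
proof (rule L2_perI)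
  show "(\<lambda>x. f x * c x) \<in> borel_measurable borel"
    by (rule borel_measurable_times[OF L2_perD(2)[OF assms(1)] borel_measurable_continuous_onI[OF assms(3)]])
  show "sq_integrable circ (\<lambda>x. f x * c x)"
    using assms by (intro sq_integrable_mult_continuous L2_perD(3)) (auto intro: continuous_on_subset)
qed (simp add: assms L2_perD(1)[OF assms(1)])

lemma L2_per_cmult: "f \<in> L2_per \<Longrightarrow> (\<lambda>x. c * f x) \<in> L2_per"
  using L2_per_mult_continuous[of f "\<lambda>x. c"] by (simp add: mult.commute)

lemma is_conjugate_lincomb:
  assumes f: "f \<in> L2_per" "is_conjugate D f \<phi>" and q: "q \<in> L2_per" "is_conjugate D q \<psi>"
  shows "is_conjugate D (\<lambda>x. f x + c * q x) (\<lambda>x. \<phi> x + c * \<psi> x)"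
proof -
  have \<phi>: "\<phi> \<in> L2_per" and \<psi>: "\<psi> \<in> L2_per" using f q by (auto simp: is_conjugate_def)
  have lin: "fc (\<lambda>x. of_real (x1 x + c * x2 x)) n = fc (\<lambda>x. of_real (x1 x)) n + c * fc (\<lambda>x. of_real (x2 x)) n"
    if "x1 \<in> L2_per" "x2 \<in> L2_per" for x1 x2 n
  proof -
    have "integrable circ (\<lambda>x. complex_of_real (x1 x))" "integrable circ (\<lambda>x. complex_of_real c * complex_of_real (x2 x))"
      using L2_perD(4)[OF that(1)] L2_perD(4)[OF that(2)]
      by (auto dest: circ.sq_integrable_imp_integrable)
    from fc_add[OF this, of n] show ?thesis by (simp add: fc_cmult)
  qed
  show ?thesis
    using f q L2_per_add[OF \<phi> L2_per_cmult[OF \<psi>]]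
    unfolding is_conjugate_iff_fc lin[OF \<phi> \<psi>] lin[OF f(1) q(1)] by (simp add: algebra_simps)
qed

text \<open>\<open>weak_deriv\<close> is an arbitrary choice, but the Fourier coefficients of every
  weak derivative are determined by \<open>f\<close>.\<close>

lemma is_conjugate_weak_deriv:
  assumes f: "has_weak_deriv f v" "\<And>x. f (x + 2 * pi) = f x" and c: "is_conjugate D v \<phi>"
  shows "is_conjugate D (weak_deriv f) \<phi>"
proof -
  have 1: "has_weak_deriv f (weak_deriv f)"
    unfolding weak_deriv_def using f(1) by (rule someI[of "has_weak_deriv f"])
  have fc: "fc (\<lambda>x. of_real (z x)) n = \<i> * of_int n * fc (\<lambda>x. of_real (f x)) n"
    if "has_weak_deriv f z" for z n
    by (rule fc_ac_deriv[OF ac_deriv_on_bounded_linear[OF bounded_linear_of_real has_weak_deriv_ac[OF that]]])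
       (use f(2)[of 0] in simp)
  show ?thesis
    using c unfolding is_conjugate_iff_fc fc[OF 1] fc[OF f(1)] .
qed

text \<open>Along the line \<open>w + \<tau> * q\<close> the functional is a cubic polynomial in
  \<open>\<tau>\<close>, because the conjugate is affine in \<open>\<tau>\<close> almost everywhere;
  the second variation is twice the quadratic coefficient.\<close>

lemma second_variation_eq:
  assumes w: "has_weak_deriv w w1" "\<And>x. w (x + 2 * pi) = w x" "continuous_on UNIV w"
    and q: "has_weak_deriv q q1" "\<And>x. q (x + 2 * pi) = q x" "continuous_on UNIV q"
    and cw: "is_conjugate (k * h) w1 cw" and r: "is_conjugate (k * h) q1 r"
  shows "second_variation g k Q m w h q q
    = 2 * (LINT x|circ. (Q - 2 * g * (w x + h)) * q x * r x - g * (q x)\<^sup>2 * (1 / k + cw x))"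
proof -
  have w1: "w1 \<in> L2_per" and q1: "q1 \<in> L2_per" using w(1) q(1) by (auto simp: has_weak_deriv_def)
  have cwL: "cw \<in> L2_per" and rL: "r \<in> L2_per" using cw r by (auto simp: is_conjugate_def)
  \<comment> \<open>\<open>e0\<close>, \<open>e1\<close>, \<open>e2\<close> are the coefficients of
    the powers of \<open>\<tau>\<close> in \<open>Q * v - g * v^2\<close> for
    \<open>v = w + h + \<tau> * q\<close>.\<close>
  define e0 where "e0 x = Q * (w x + h) - g * (w x + h)\<^sup>2" for x
  define e1 where "e1 x = (Q - 2 * g * (w x + h)) * q x" for x
  define e2 where "e2 x = - g * (q x)\<^sup>2" for x
  define a where "a x = 1 / k + cw x" for x
  have cont: "continuous_on A e0" "continuous_on A e1" "continuous_on A e2" for A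
    unfolding e0_def e1_def e2_def
    by (intro continuous_intros continuous_on_subset[OF w(3)] continuous_on_subset[OF q(3)]; simp)+
  have ci: "continuous_on {0..2 * pi} (\<lambda>x. 1 / k)" by (intro continuous_intros)
  have aL: "sq_integrable circ a"
    unfolding a_def by (intro sq_integrable_add sq_integrable_circ_continuous ci L2_perD(3) cwL)
  have int: "integrable circ (\<lambda>x. e x * z x)" if "\<And>A. continuous_on A e" "sq_integrable circ z" for e z :: "real \<Rightarrow> real"
    using sq_integrable_circ_continuous[OF that(1)] that(2) by (rule integrable_mult_sq_integrable)
  note ints = int[OF cont(1) aL] int[OF cont(2) aL] int[OF cont(3) aL]
    int[OF cont(1) L2_perD(3)[OF rL]] int[OF cont(2) L2_perD(3)[OF rL]] int[OF cont(3) L2_perD(3)[OF rL]]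
  define I0 where "I0 = (LINT x|circ. e0 x * a x + m\<^sup>2 / (k * h))"
  define I1 where "I1 = (LINT x|circ. e0 x * r x + e1 x * a x)"
  define I2 where "I2 = (LINT x|circ. e1 x * r x + e2 x * a x)"
  define I3 where "I3 = (LINT x|circ. e2 x * r x)"
  have Lam: "Lam g k Q m (\<lambda>x. w x + s * q x + t * q x) h
      = I0 + (s + t) * I1 + (s + t)\<^sup>2 * I2 + (s + t) ^ 3 * I3" for s t
  proof -
    \<comment> \<open>Both variations have the same direction, so the functional depends on
      \<open>s + t\<close> alone.\<close>
    define \<tau> where "\<tau> = s + t"
    define f where "f x = w x + \<tau> * q x" for x
    have f: "(\<lambda>x. w x + s * q x + t * q x) = f"
      by (rule ext) (simp add: f_def \<tau>_def algebra_simps)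
    have fper: "f (x + 2 * pi) = f x" for x by (simp add: f_def w(2) q(2))
    have "ac_deriv_on 0 (2 * pi) f (\<lambda>x. w1 x + \<tau> * q1 x)"
      unfolding f_def
      by (intro ac_deriv_on_add ac_deriv_on_bounded_linear[OF bounded_linear_mult_right]
          has_weak_deriv_ac w(1) q(1))
    then have fw: "has_weak_deriv f (\<lambda>x. w1 x + \<tau> * q1 x)"
      by (intro has_weak_derivI fper L2_per_add L2_per_cmult w1 q1)
    note wd = conj_op_properties[OF is_conjugate_weak_deriv[OF fw fper is_conjugate_lincomb[OF w1 cw q1 r]]]
    have cL: "conj_op (k * h) (weak_deriv f) \<in> L2_per"
      using wd(1) by (simp add: is_conjugate_def)
    have "Lam g k Q m f h = (LINT x|circ. (Q * (f x + h) - g * (f x + h)\<^sup>2) * (1 / k + (cw x + \<tau> * r x)) + m\<^sup>2 / (k * h))"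
      unfolding Lam_def int2pi_circ
    proof (rule integral_cong_AE)
      have fc: "f \<in> borel_measurable circ"
        unfolding f_def
        by (intro borel_measurable_circ_continuous continuous_intros continuous_on_subset[OF w(3)]
            continuous_on_subset[OF q(3)]) auto
      note [measurable] = fc sq_integrable_measurable[OF L2_perD(3)[OF cL]]
        sq_integrable_measurable[OF L2_perD(3)[OF cwL]] sq_integrable_measurable[OF L2_perD(3)[OF rL]]
      show "(\<lambda>x. (Q * (f x + h) - g * (f x + h)\<^sup>2) * (1 / k + conj_op (k * h) (weak_deriv f) x) + m\<^sup>2 / (k * h))
          \<in> borel_measurable circ" by measurable
      show "(\<lambda>x. (Q * (f x + h) - g * (f x + h)\<^sup>2) * (1 / k + (cw x + \<tau> * r x)) + m\<^sup>2 / (k * h))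
          \<in> borel_measurable circ" by measurable
      show "AE x in circ. (Q * (f x + h) - g * (f x + h)\<^sup>2) * (1 / k + conj_op (k * h) (weak_deriv f) x) + m\<^sup>2 / (k * h)
         = (Q * (f x + h) - g * (f x + h)\<^sup>2) * (1 / k + (cw x + \<tau> * r x)) + m\<^sup>2 / (k * h)"
        using wd(2) by eventually_elim simp
    qed
    also have "\<dots> = (LINT x|circ. (e0 x * a x + m\<^sup>2 / (k * h)) + \<tau> * (e0 x * r x + e1 x * a x)
        + \<tau>\<^sup>2 * (e1 x * r x + e2 x * a x) + \<tau> ^ 3 * (e2 x * r x))"
      by (intro Bochner_Integration.integral_cong refl)
         (simp add: e0_def e1_def e2_def a_def f_def, algebra)
    also have "\<dots> = I0 + \<tau> * I1 + \<tau>\<^sup>2 * I2 + \<tau> ^ 3 * I3"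
      unfolding I0_def I1_def I2_def I3_def using ints by simp
    finally show ?thesis by (simp add: f \<tau>_def)
  qed
  have d1: "deriv (\<lambda>t. Lam g k Q m (\<lambda>x. w x + s * q x + t * q x) h) 0 = I1 + 2 * s * I2 + 3 * s\<^sup>2 * I3" for s
    unfolding Lam by (rule DERIV_imp_deriv) (auto intro!: derivative_eq_intros)
  have "second_variation g k Q m w h q q = 2 * I2"
    unfolding second_variation_def d1
    by (rule DERIV_imp_deriv) (auto intro!: derivative_eq_intros)
  also have "I2 = (LINT x|circ. (Q - 2 * g * (w x + h)) * q x * r x - g * (q x)\<^sup>2 * (1 / k + cw x))"
    by (simp add: I2_def e1_def e2_def a_def)
  finally show ?thesis .
qed

section \<open>Plotnikov's transform\<close>

text \<open>The difference of the two integrands is an exact derivative plus the imaginary part of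
  \<open>F F' / W\<^sup>2\<close>, where \<open>F = R + i q\<close> and \<open>a + i b = W\<close>; primes are written as suffix \<open>1\<close>.\<close>

lemma plotnikov_pointwise_identity:
  fixes a b a1 b1 u A u1 A1 M B Y :: real
  assumes Y: "Y = a\<^sup>2 + b\<^sup>2" "Y \<noteq> 0" and B: "B \<noteq> 0" and bern: "a * a1 + b * b1 = b * Y\<^sup>2 / B"
  defines "p \<equiv> a * A - b * u" and "q \<equiv> u * a + b * A"
    and "p1 \<equiv> a1 * A + a * A1 - b1 * u - b * u1" and "q1 \<equiv> a1 * u + a * u1 + b1 * A + b * A1"
    and "\<Phi> \<equiv> (b1 * a - a1 * b) / Y + Y / B * a"
  defines "R \<equiv> p - M"
  shows "(u + M * b / Y) * (A1 - \<Phi> * u) - (q * p1 / Y - q\<^sup>2 * a / B)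
    = ((R * q1 + q * p1) * (a\<^sup>2 - b\<^sup>2) - 2 * a * b * (R * p1 - q * q1)) / (2 * Y\<^sup>2)
      - ((p1 * q + R * q1) / Y - 2 * R * q * b / B) / 2"
proof -
  \<comment> \<open>With \<open>1 / B\<close> and \<open>1 / Y\<close> as atoms subject to
    \<open>y * Y = 1\<close>, what follows is polynomial algebra.\<close>
  define \<beta> where "\<beta> = 1 / B"
  define y where "y = 1 / Y"
  have yY: "y * Y = 1" using Y by (simp add: y_def)
  have bern': "a * a1 + b * b1 = b * Y\<^sup>2 * \<beta>" using bern by (simp add: \<beta>_def)
  have \<Phi>: "\<Phi> = (b1 * a - a1 * b) * y + Y * \<beta> * a" by (simp add: \<Phi>_def y_def \<beta>_def)
  \<comment> \<open>The terms \<open>a * p1 + b * q1\<close> are the real part of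
    \<open>cnj W * F'\<close>. This is the one place where Bernoulli's law enters, to replace
    \<open>a * a1 + b * b1\<close>.\<close>
  have "Y * (A1 - \<Phi> * u) = a * p1 + b * q1 - Y * (Y * q * \<beta>)"
  proof -
    have "Y * (A1 - \<Phi> * u) = Y * A1 - (b1 * a - a1 * b) * u * (y * Y) - Y * Y * \<beta> * a * u"
      unfolding \<Phi> by (simp add: algebra_simps)
    also have "\<dots> = Y * A1 + (a * a1 + b * b1) * A - (b1 * a - a1 * b) * u
        - b * Y\<^sup>2 * \<beta> * A - Y * Y * \<beta> * a * u"
      unfolding yY bern' by simp
    also have "\<dots> = a * p1 + b * q1 - Y * (Y * q * \<beta>)"
      unfolding Y(1) p1_def q1_def q_def by (simp add: power2_eq_square algebra_simps)
    finally show ?thesis .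
  qed
  then have 1: "A1 - \<Phi> * u = y * (a * p1 + b * q1) - Y * q * \<beta>"
    using yY by algebra
  \<comment> \<open>The right-hand side is the imaginary part of \<open>cnj W * F\<close>.\<close>
  have "Y * (u + M * b * y) = a * q - b * R"
  proof -
    have "Y * (u + M * b * y) = Y * u + M * b * (y * Y)" by (simp add: algebra_simps)
    also have "\<dots> = a * q - b * R"
      unfolding yY unfolding Y(1) R_def p_def q_def by (simp add: power2_eq_square algebra_simps)
    finally show ?thesis .
  qed
  then have 2: "u + M * b * y = y * (a * q - b * R)" using yY by algebra
  \<comment> \<open>The mechanism is
    \<open>Im z * Re z' = (Im (z * z') + Im (z * cnj z')) / 2\<close> for
    \<open>z = cnj W * F\<close> and \<open>z' = cnj W * F'\<close>: the first summand is the trace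
    term, and the second combines with the remaining terms into the total derivative.\<close>
  have "(u + M * b * y) * (A1 - \<Phi> * u) - (q * p1 * y - q\<^sup>2 * a * \<beta>)
    = ((R * q1 + q * p1) * (a\<^sup>2 - b\<^sup>2) - 2 * a * b * (R * p1 - q * q1)) * y\<^sup>2 / 2
      - ((p1 * q + R * q1) * y - 2 * R * q * b * \<beta>) / 2"
  proof -
    have y1: "y = y\<^sup>2 * (a\<^sup>2 + b\<^sup>2)" using yY unfolding Y(1) by algebra
    have "y * (a * q - b * R) * (y * (a * p1 + b * q1) - Y * q * \<beta>)
        = y\<^sup>2 * (a * q - b * R) * (a * p1 + b * q1) - (y * Y) * (a * q - b * R) * q * \<beta>"
      by (simp add: power2_eq_square algebra_simps)
    then have "y * (a * q - b * R) * (y * (a * p1 + b * q1) - Y * q * \<beta>) - (q * p1 * y - q\<^sup>2 * a * \<beta>)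
        = y\<^sup>2 * (a * q - b * R) * (a * p1 + b * q1) + b * R * q * \<beta> - q * p1 * y"
      unfolding yY by (simp add: power2_eq_square algebra_simps)
    also have "\<dots> = ((R * q1 + q * p1) * (a\<^sup>2 - b\<^sup>2) - 2 * a * b * (R * p1 - q * q1)) * y\<^sup>2 / 2
      - ((p1 * q + R * q1) * y - 2 * R * q * b * \<beta>) / 2"
      by (subst (2 4) y1) (simp add: field_simps power2_eq_square)
    finally show ?thesis unfolding 1 2 .
  qed
  then show ?thesis by (simp add: y_def \<beta>_def power_divide)
qed

lemma deriv_periodic:
  fixes f :: "real \<Rightarrow> real"
  assumes "\<And>x. f (x + c) = f x" "\<And>x. (f has_real_derivative f' x) (at x)"
  shows "f' (x + c) = f' x"
proof -
  have "((\<lambda>x. f (x + c)) has_real_derivative f' (x + c)) (at x)"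
    using assms(2)[of "x + c"] by (simp add: DERIV_shift)
  then show ?thesis using DERIV_unique[OF _ assms(2)] by (simp add: assms(1))
qed

lemma Hoelder_continuous:
  fixes f :: "real \<Rightarrow> real"
  assumes "\<And>x y. \<bar>f x - f y\<bar> \<le> K * \<bar>x - y\<bar> powr \<alpha>" and \<alpha>: "\<alpha> > 0"
  shows "continuous_on UNIV f"
proof -
  have "(f \<longlongrightarrow> f x) (at x)" for x
  proof (rule Lim_null_comparison[THEN LIM_zero_cancel])
    show "\<forall>\<^sub>F y in at x. norm (f y - f x) \<le> K * \<bar>y - x\<bar> powr \<alpha>"
      using assms(1) by simp
    have "((\<lambda>y. \<bar>y - x\<bar> powr \<alpha>) \<longlongrightarrow> \<bar>x - x\<bar> powr \<alpha>) (at x)"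
      using \<alpha> by (intro tendsto_powr' tendsto_intros) auto
    from tendsto_mult_right_zero[OF this[simplified]]
    show "((\<lambda>y. K * \<bar>y - x\<bar> powr \<alpha>) \<longlongrightarrow> 0) (at x)" .
  qed
  then show ?thesis by (simp add: continuous_on_def)
qed

lemma ac_deriv_on_Complex:
  assumes "ac_deriv_on c d f f'" "ac_deriv_on c d f2 f2'"
  shows "ac_deriv_on c d (\<lambda>x. Complex (f x) (f2 x)) (\<lambda>x. Complex (f' x) (f2' x))"
proof -
  have "ac_deriv_on c d (\<lambda>x. of_real (f x) + \<i> * of_real (f2 x)) (\<lambda>x. of_real (f' x) + \<i> * of_real (f2' x))"
    by (intro ac_deriv_on_add ac_deriv_on_bounded_linear[OF bounded_linear_mult_right]
        ac_deriv_on_bounded_linear[OF bounded_linear_of_real] assms)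
  then show ?thesis by (simp add: Complex_eq)
qed

lemma ac_deriv_on_DERIV:
  fixes f f' :: "real \<Rightarrow> real"
  assumes "\<And>x. (f has_real_derivative f' x) (at x)" "continuous_on UNIV f'"
  shows "ac_deriv_on c d f f'"
  using assms
  by (intro ac_deriv_on_C1)
     (auto intro: continuous_on_subset has_field_derivative_at_within
       simp flip: has_real_derivative_iff_has_vector_derivative)

lemma continuous_on_Complex:
  "continuous_on A f \<Longrightarrow> continuous_on A f2 \<Longrightarrow> continuous_on A (\<lambda>x. Complex (f x) (f2 x))"
  by (simp add: Complex_eq) (intro continuous_intros)

section \<open>Regularity of a graph solution\<close>

locale graph_solution =
  fixes g h k Q m \<alpha> :: real and w :: "real \<Rightarrow> real"
  assumes g: "g > 0" and h: "h > 0" and k: "k > 0" and \<alpha>: "\<alpha> > 0"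
    and reg: "regular_graph_solution \<alpha> g h k Q m w"
begin

definition "b = deriv w"
definition "b' = deriv b"
definition "C = conj_op (k * h) b"
definition "a x = 1 / k + C x"
definition "B = bernoulli_B g h k m"
definition "P x = Q - 2 * g * (w x + h)"
definition "Y x = (a x)\<^sup>2 + (b x)\<^sup>2"
text \<open>Differentiating \<open>P * Y = g * B\<close>, where \<open>P' = - 2 * g * b\<close>,
  gives \<open>a * a' + b * b' = b * Y^2 / B\<close>; this is solved for \<open>a'\<close>.\<close>

definition "a' x = (b x * (Y x)\<^sup>2 / B - b x * b' x) / a x"

lemma D: "k * h > 0"
  using h k by simp

lemma w_C2: "w \<in> C2_Hoelder_per \<alpha>"
  using reg by (simp add: regular_graph_solution_def)

lemma w_per: "w (x + 2 * pi) = w x"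
  using w_C2 by (simp add: C2_Hoelder_per_def periodic2pi_def)

lemma DERIV_w: "(w has_real_derivative b x) (at x)"
  using w_C2 by (simp add: C2_Hoelder_per_def b_def DERIV_deriv_iff_real_differentiable)

lemma DERIV_b: "(b has_real_derivative b' x) (at x)"
  using w_C2 by (simp add: C2_Hoelder_per_def b_def b'_def DERIV_deriv_iff_real_differentiable)

lemma b_per: "b (x + 2 * pi) = b x"
  by (rule deriv_periodic[OF w_per DERIV_w])

lemma b'_per: "b' (x + 2 * pi) = b' x"
  by (rule deriv_periodic[OF b_per DERIV_b])

lemma cont_w: "continuous_on UNIV w"
  by (intro continuous_at_imp_continuous_on ballI DERIV_isCont[OF DERIV_w])

lemma cont_b: "continuous_on UNIV b"
  by (intro continuous_at_imp_continuous_on ballI DERIV_isCont[OF DERIV_b])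

lemma cont_b': "continuous_on UNIV b'"
proof -
  obtain K where "\<And>x y. \<bar>b' x - b' y\<bar> \<le> K * \<bar>x - y\<bar> powr \<alpha>"
    using w_C2 unfolding C2_Hoelder_per_def b'_def b_def by blast
  then show ?thesis using \<alpha> by (rule Hoelder_continuous)
qed

lemma a_pos: "a x > 0"
  using reg by (simp add: regular_graph_solution_def a_def C_def b_def)

lemma Y_pos: "Y x > 0"
  using a_pos[of x] by (simp add: Y_def add_pos_nonneg)

lemma B_pos: "B > 0"
  using reg by (simp add: regular_graph_solution_def B_def)

lemma bernoulli: "P x * Y x = g * B"
proof -
  have "(m / (k * h))\<^sup>2 = P x * ((b x)\<^sup>2 + (a x)\<^sup>2)"
    using reg by (simp add: regular_graph_solution_def P_def b_def a_def C_def)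
  then show ?thesis using g by (simp add: Y_def B_def bernoulli_B_def add.commute)
qed

lemma P_pos: "P x > 0"
  using bernoulli[of x] Y_pos[of x] B_pos g by (metis mult_pos_pos zero_less_mult_pos2)

lemma DERIV_P: "(P has_real_derivative - 2 * g * b x) (at x)"
  unfolding P_def[abs_def] by (auto intro!: derivative_eq_intros DERIV_w)

lemma P_per: "P (x + 2 * pi) = P x"
  by (simp add: P_def w_per)

lemma a_eq: "a x = sqrt (g * B / P x - (b x)\<^sup>2)"
proof -
  have "g * B / P x - (b x)\<^sup>2 = (a x)\<^sup>2"
    using bernoulli[of x] P_pos[of x] by (simp add: Y_def field_simps)
  then show ?thesis using a_pos[of x] by simp
qed

text \<open>The graph condition allows to solve Bernoulli's law for \<open>a\<close>, so that \<open>a\<close> is as smooth as \<open>w'\<close>.\<close>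

lemma DERIV_a: "(a has_real_derivative a' x) (at x)"
proof -
  have pos: "g * B / P x - (b x)\<^sup>2 > 0"
    using a_eq[of x] a_pos[of x] by (metis real_sqrt_gt_0_iff)
  have Y: "g * B / P x = Y x" using bernoulli[of x] P_pos[of x] by (simp add: field_simps)
  have P: "P x = g * B / Y x" using bernoulli[of x] Y_pos[of x] by (simp add: field_simps)
  have "((\<lambda>x. sqrt (g * B / P x - (b x)\<^sup>2)) has_real_derivative
      (- (g * B * (- 2 * g * b x)) / (P x * P x) - 2 * b x * b' x) * (inverse (sqrt (g * B / P x - (b x)\<^sup>2)) / 2)) (at x)"
    using pos P_pos[of x]
    by (auto intro!: derivative_eq_intros DERIV_P DERIV_b simp: power2_eq_square)
  also have "(\<lambda>x. sqrt (g * B / P x - (b x)\<^sup>2)) = a" by (simp add: a_eq fun_eq_iff)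
  also have "(- (g * B * (- 2 * g * b x)) / (P x * P x) - 2 * b x * b' x) * (inverse (a x) / 2) = a' x"
    unfolding a'_def unfolding P
    using g B_pos Y_pos[of x] a_pos[of x] by (simp add: field_simps power2_eq_square)
  finally show ?thesis .
qed

lemma a_a': "a x * a' x + b x * b' x = b x * (Y x)\<^sup>2 / B"
  using a_pos[of x] by (simp add: a'_def)

lemma cont_a: "continuous_on UNIV a"
  by (intro continuous_at_imp_continuous_on ballI DERIV_isCont[OF DERIV_a])

lemma cont_P: "continuous_on UNIV P"
  by (intro continuous_at_imp_continuous_on ballI DERIV_isCont[OF DERIV_P])

lemma cont_Y: "continuous_on UNIV Y"
  unfolding Y_def[abs_def] by (intro continuous_intros cont_a cont_b)

lemma cont_a': "continuous_on UNIV a'"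
  unfolding a'_def[abs_def]
  using a_pos B_pos by (intro continuous_intros cont_a cont_b cont_b' cont_Y) (auto simp: less_imp_neq[symmetric])

lemma b_L2: "b \<in> L2_per"
  by (rule L2_per_continuous[OF b_per cont_b])

lemma conj_C: "is_conjugate (k * h) b C"
  unfolding C_def by (rule is_conjugate_conj_op[OF b_L2 D])

lemma C_per: "C (x + 2 * pi) = C x"
  using conj_C by (auto simp: is_conjugate_def L2_perD(1))

lemma a_per: "a (x + 2 * pi) = a x"
  by (simp add: a_def C_per)

lemma a'_per: "a' (x + 2 * pi) = a' x"
  by (rule deriv_periodic[OF a_per DERIV_a])

lemma has_weak_deriv_w: "has_weak_deriv w b"
  by (intro has_weak_derivI b_L2 w_per ac_deriv_on_DERIV DERIV_w cont_b)

lemma fc_b_0: "fc (\<lambda>x. of_real (b x)) 0 = 0"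
  using ac_deriv_on_circ(2)[OF has_weak_deriv_ac[OF has_weak_deriv_w]] w_per[of 0] by (simp add: fc_def)

section \<open>The function \<open>W\<close> and its reciprocal as traces\<close>

definition "W x = Complex (a x) (b x)"
definition "W' x = Complex (a' x) (b' x)"

lemma integrable_Complex:
  assumes "integrable circ f" "integrable circ f2"
  shows "integrable circ (\<lambda>x. Complex (f x) (f2 x))"
  using assms by (simp add: Complex_eq)

lemma strip_trace_bC: "strip_trace (k * h) (\<lambda>x. Complex (C x) (b x))"
  by (rule strip_trace_is_conjugate[OF conj_C b_L2 fc_b_0 D])

lemma integrable_L2_per: "f \<in> L2_per \<Longrightarrow> integrable circ f"
  by (intro circ.sq_integrable_imp_integrable L2_perD(3))

lemma integrable_bC: "integrable circ (\<lambda>x. Complex (C x) (b x))"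
  using conj_C b_L2 by (intro integrable_Complex integrable_L2_per) (auto simp: is_conjugate_def)

lemma integrable_const_circ: "integrable circ (\<lambda>x. c :: complex)"
  by simp

lemma cont_W: "continuous_on UNIV W"
  unfolding W_def[abs_def] by (intro continuous_on_Complex cont_a cont_b)

lemma strip_trace_W: "strip_trace (k * h) W"
proof -
  have "W = (\<lambda>x. of_real (1 / k) + Complex (C x) (b x))"
    by (auto simp: W_def a_def complex_eq_iff)
  then show ?thesis
    using strip_trace_add[OF strip_trace_const[of _ "1 / k"] strip_trace_bC integrable_const_circ integrable_bC] by simp
qed

text \<open>By Bernoulli's law \<open>Z = g B / W\<close>.\<close>

definition "Z x = of_real (P x) * cnj (W x)"

text \<open>Multiplied by \<open>g\<close>, the water-wave equation expresses \<open>P * a\<close>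
  by a constant and the conjugates of \<open>w'\<close> and \<open>w * w'\<close>, with the same two
  coefficients that \<open>- P * b\<close> has in terms of \<open>w'\<close> and
  \<open>w * w'\<close>. So \<open>Z\<close> is a real combination of traces.\<close>

lemma strip_trace_Z: "strip_trace (k * h) Z"
proof -
  define wb where "wb x = w x * b x" for x
  define E where "E = conj_op (k * h) wb"
  have wb: "wb \<in> L2_per"
    unfolding wb_def[abs_def] by (intro L2_per_continuous continuous_intros cont_w cont_b) (simp add: w_per b_per)
  have E: "is_conjugate (k * h) wb E" unfolding E_def by (rule is_conjugate_conj_op[OF wb D])
  \<comment> \<open>\<open>w * w'\<close> is half the derivative of the periodic \<open>w^2\<close>,
    hence of mean zero, as its trace requires.\<close>
  have "ac_deriv_on 0 (2 * pi) (\<lambda>x. w x * w x) (\<lambda>x. b x * w x + w x * b x)"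
    by (intro ac_deriv_on_mult has_weak_deriv_ac has_weak_deriv_w)
  from ac_deriv_on_circ(2)[OF this]
  have "(LINT x|circ. 2 * wb x) = 0" using w_per[of 0] by (simp add: wb_def mult.commute[of "b _"])
  then have wb0: "fc (\<lambda>x. of_real (wb x)) 0 = 0" using integrable_L2_per[OF wb] by (simp add: fc_def)
  define c where "c = mean2pi (\<lambda>y. w y * C y)"
  define \<mu> where "\<mu> = (Q - 2 * g * h) / g"
  have eq: "\<mu> * C x = w x / k + w x * C x + E x - c" for x
    using reg by (simp add: regular_graph_solution_def \<mu>_def C_def b_def E_def wb_def[abs_def] c_def)
  have P: "P x = \<mu> * g - 2 * g * w x" for x 
  proof -
    have "\<mu> * g = Q - 2 * g * h" using g by (simp add: \<mu>_def)
    then show ?thesis by (simp add: P_def algebra_simps)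
  qed
  have "Z x = of_real (\<mu> * g / k - 2 * g * c) +
      (of_real (- (\<mu> * g)) * Complex (C x) (b x) + of_real (2 * g) * Complex (E x) (wb x))" for x
  proof -
    have "P x * a x = \<mu> * g / k - 2 * g * c - \<mu> * g * C x + 2 * g * E x"
    proof -
      have "P x * a x = \<mu> * g / k - 2 * g * (w x / k + w x * C x) + g * (\<mu> * C x)"
        by (simp add: P a_def algebra_simps)
      also have "w x / k + w x * C x = \<mu> * C x - E x + c" using eq[of x] by simp
      finally show ?thesis by (simp add: algebra_simps)
    qed
    moreover have "- (P x * b x) = - (\<mu> * g * b x) + 2 * g * wb x"
      by (simp add: P wb_def algebra_simps)
    ultimately show ?thesis by (simp add: Z_def W_def complex_eq_iff)
  qed
  moreover have "integrable circ (\<lambda>x. Complex (E x) (wb x))"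
    using wb E by (intro integrable_Complex integrable_L2_per) (auto simp: is_conjugate_def)
  then have "strip_trace (k * h) (\<lambda>x. of_real (\<mu> * g / k - 2 * g * c) +
      (of_real (- (\<mu> * g)) * Complex (C x) (b x) + of_real (2 * g) * Complex (E x) (wb x)))"
    by (intro strip_trace_add strip_trace_const strip_trace_of_real_mult integrable_const_circ
        Bochner_Integration.integrable_add integrable_mult_right
        strip_trace_bC integrable_bC strip_trace_is_conjugate[OF E wb wb0 D])
  ultimately show ?thesis by presburger
qed

lemma cont_Z: "continuous_on UNIV Z"
  unfolding Z_def[abs_def] by (intro continuous_intros cont_P cont_W)

lemma ac_W: "ac_deriv_on c d W W'"
  unfolding W_def[abs_def] W'_def[abs_def]
  by (intro ac_deriv_on_Complex ac_deriv_on_DERIV DERIV_a DERIV_b cont_a' cont_b')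

lemma W_fun_eq: "W_fun h k w = W"
  by (simp add: fun_eq_iff W_fun_def W_def a_def C_def b_def)

lemma cmod_W: "(cmod (W x))\<^sup>2 = Y x"
  by (simp add: W_def Y_def cmod_power2)

section \<open>Plotnikov's potential and the integral identity\<close>

definition "\<Phi> x = (b' x * a x - a' x * b x) / Y x + Y x / B * a x"

lemma plotnikov_potential_eq: "plotnikov_potential g h k m w x = \<Phi> x"
proof -
  have "(W has_vector_derivative W' x) (at x)"
  proof -
    have "((\<lambda>x. of_real (a x) + \<i> * of_real (b x)) has_vector_derivative of_real (a' x) + \<i> * of_real (b' x)) (at x)"
      using DERIV_a[of x] DERIV_b[of x]
      by (auto intro!: derivative_intros simp: has_real_derivative_iff_has_vector_derivative)
    then show ?thesis by (simp add: W_def[abs_def] W'_def Complex_eq)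
  qed
  then have "vector_derivative W (at x) = W' x" by (rule vector_derivative_at)
  then show ?thesis
    unfolding plotnikov_potential_def W_fun_eq cmod_W \<Phi>_def
    by (simp add: W_def W'_def Y_def Im_divide B_def a_def C_def b_def[symmetric])
qed

lemma cont_\<Phi>: "continuous_on UNIV \<Phi>"
  unfolding \<Phi>_def[abs_def]
  using Y_pos B_pos
  by (intro continuous_intros cont_a cont_b cont_a' cont_b' cont_Y) (auto simp: less_imp_neq[symmetric])

text \<open>\<open>M\<close> may be any real number: it enters through \<open>F = V - M\<close>, and
  every real constant is a trace.\<close>

theorem second_variation_plotnikov:
  fixes M :: real
  assumes u: "u \<in> H1_per0"
  defines "A1 \<equiv> conj_op (k * h) (weak_deriv u)"
  shows "second_variation g k Q m w h (plotnikov_transform h k w u) (plotnikov_transform h k w u) =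
    2 * g * B * int2pi (\<lambda>x. u x * (A1 x - \<Phi> x * u x))
    + 2 * g * B * M * int2pi (\<lambda>x. b x / Y x * (A1 x - \<Phi> x * u x))"
proof -
  define u1 where "u1 = weak_deriv u"
  define A where "A = conj_op (k * h) u"
  have u_per: "u (x + 2 * pi) = u x" for x using u by (simp add: H1_per0_def periodic2pi_def)
  obtain v where v: "has_weak_deriv u v" using u by (auto simp: H1_per0_def)
  then have u1: "has_weak_deriv u u1"
    unfolding u1_def weak_deriv_def by (rule someI[of "has_weak_deriv u"])
  then have u1L: "u1 \<in> L2_per" by (simp add: has_weak_deriv_def)
  have A1L: "A1 \<in> L2_per"
    using is_conjugate_conj_op[OF u1L D] by (simp add: is_conjugate_def A1_def u1_def)
  note A_props = conj_op_ac_deriv[OF u1 u_per D, folded A_def, unfolded u1_def, folded A1_def]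
  have A_per: "A (x + 2 * pi) = A x" for x
    using A_props(3) by (auto simp: is_conjugate_def L2_perD(1))
  note acu = has_weak_deriv_ac[OF u1]
  have cont_u: "continuous_on UNIV u"
    by (rule continuous_on_UNIV_periodic_ac[OF u_per L2_perD(1)[OF u1L] acu])
  note cont = cont_u A_props(2) cont_a cont_b cont_a' cont_b' cont_P cont_Y cont_\<Phi>
  note cont' = cont[THEN continuous_on_subset, OF subset_UNIV]
  have uL: "u \<in> L2_per" by (rule L2_per_continuous[OF u_per cont_u])
  have u0: "fc (\<lambda>x. of_real (u x)) 0 = 0"
    using u by (simp add: H1_per0_def mean2pi_def int2pi_circ fc_def)

  define U where "U x = Complex (A x) (u x)" for x
  define U1 where "U1 x = Complex (A1 x) (u1 x)" for x
  define V where "V x = W x * U x" for x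
  define V1 where "V1 x = W' x * U x + W x * U1 x" for x
  define p q p1 q1 where "p x = a x * A x - b x * u x" and "q x = u x * a x + b x * A x"
    and "p1 x = a' x * A x + a x * A1 x - b' x * u x - b x * u1 x"
    and "q1 x = a' x * u x + a x * u1 x + b' x * A x + b x * A1 x" for x
  have V: "V x = Complex (p x) (q x)" for x
    by (simp add: V_def U_def W_def p_def q_def complex_eq_iff algebra_simps)
  have V1: "V1 x = Complex (p1 x) (q1 x)" for x
    by (simp add: V1_def U_def U1_def W_def W'_def p1_def q1_def complex_eq_iff algebra_simps)
  have q: "plotnikov_transform h k w u = q"
    by (simp add: fun_eq_iff plotnikov_transform_def q_def a_def C_def b_def A_def)
  have cont_p: "continuous_on UNIV p" and cont_q: "continuous_on UNIV q"
    unfolding p_def[abs_def] q_def[abs_def] by (intro continuous_intros cont)+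
  have cont_UV: "continuous_on UNIV U" "continuous_on UNIV V"
    unfolding U_def[abs_def] V[abs_def] by (intro continuous_on_Complex cont cont_p cont_q)+
  have sq: "sq_integrable circ F" if "continuous_on UNIV F" for F :: "real \<Rightarrow> complex"
    by (rule sq_integrable_circ_continuous[OF continuous_on_subset[OF that subset_UNIV]])
  have V_per: "V (2 * pi) = V 0"
    using a_per[of 0] b_per[of 0] A_per[of 0] u_per[of 0] by (simp add: V_def W_def U_def)
  have acV: "ac_deriv_on 0 (2 * pi) V V1"
    unfolding V_def[abs_def] V1_def[abs_def] U_def[abs_def] U1_def[abs_def]
    by (intro ac_deriv_on_mult ac_W ac_deriv_on_Complex A_props(1) acu)

  have trU: "strip_trace (k * h) U"
    unfolding U_def[abs_def] by (rule strip_trace_is_conjugate[OF A_props(3) uL u0 D])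
  have trV: "strip_trace (k * h) V"
    unfolding V_def[abs_def] by (intro strip_trace_mult strip_trace_W trU sq cont_W cont_UV)
  have trV1: "strip_trace (k * h) V1"
    by (rule strip_trace_deriv[OF trV acV V_per])

  have L2mult: "(\<lambda>x. f x * c x) \<in> L2_per" "(\<lambda>x. c x * f x) \<in> L2_per"
    if "f \<in> L2_per" "\<And>x. c (x + 2 * pi) = c x" "continuous_on UNIV c" for f c
    using L2_per_mult_continuous[OF that] by (simp_all add: mult.commute)
  have L2diff: "(\<lambda>x. f x - f' x) \<in> L2_per" if "f \<in> L2_per" "f' \<in> L2_per" for f f'
    using L2_per_add[OF that(1) L2_per_cmult[OF that(2), of "-1"]] by simp
  have AL: "A \<in> L2_per" using A_props(3) by (simp add: is_conjugate_def)
  have p1L: "p1 \<in> L2_per" and q1L: "q1 \<in> L2_per"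
    unfolding p1_def[abs_def] q1_def[abs_def]
    by (intro L2_per_add L2diff L2mult A1L u1L uL AL a_per b_per a'_per b'_per cont)+
  have acq: "ac_deriv_on 0 (2 * pi) q q1" and acp: "ac_deriv_on 0 (2 * pi) p p1"
    using ac_deriv_on_bounded_linear[OF bounded_linear_Im acV]
      ac_deriv_on_bounded_linear[OF bounded_linear_Re acV] by (simp_all add: V V1)
  have q_per: "q (x + 2 * pi) = q x" and p_per: "p (x + 2 * pi) = p x" for x
    by (simp_all add: q_def p_def a_per b_per A_per u_per)
  have wq: "has_weak_deriv q q1" by (rule has_weak_derivI[OF q1L q_per acq])
  have sqV1: "sq_integrable circ V1"
  proof (rule sq_integrable_bound[where C=1])
    show "sq_integrable circ (\<lambda>x. of_real (p1 x) + of_real (q1 x) * \<i>)"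
      by (intro sq_integrable_add sq_integrable_mult_continuous L2_perD(4) p1L q1L continuous_intros)
    show "V1 \<in> borel_measurable circ"
      using ac_deriv_on_circ(1)[OF acV] by simp
  qed (simp add: V1 Complex_eq mult.commute)
  \<comment> \<open>Periodicity of \<open>p\<close> gives \<open>p1\<close> mean zero, so no
    constant has to be subtracted.\<close>
  have conj_q1: "is_conjugate (k * h) q1 p1"
    using is_conjugate_strip_trace[OF trV1 ac_deriv_on_circ(1)[OF acV] D, of 0]
      ac_deriv_on_circ(2)[OF acp] p_per[of 0] p1L by (simp add: V1)

  have second: "second_variation g k Q m w h q q
      = 2 * (LINT x|circ. P x * q x * p1 x - g * (q x)\<^sup>2 * a x)"
    using second_variation_eq[OF has_weak_deriv_w w_per cont_w wq q_per cont_q conj_C conj_q1]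
    by (simp add: P_def a_def)

  define F where "F x = V x + of_real (- M)" for x
  have cont_F: "continuous_on UNIV F"
    unfolding F_def[abs_def] by (intro continuous_intros cont_UV)
  have trF: "strip_trace (k * h) F"
    unfolding F_def[abs_def]
    by (intro strip_trace_add strip_trace_const trV integrable_const_circ circ.sq_integrable_imp_integrable sq cont_UV)
  \<comment> \<open>\<open>V1\<close> is only square integrable, so all continuous factors are
    collected in \<open>G\<close>. By Bernoulli's law \<open>V1 * G\<close> is
    \<open>F * F' / W^2\<close> times \<open>(g * B)^2\<close>.\<close>
  define G where "G x = F x * (Z x * Z x)" for x
  have cont_ZZ: "continuous_on UNIV (\<lambda>x. Z x * Z x)" by (intro continuous_intros cont_Z)
  have cont_G: "continuous_on UNIV G"
    unfolding G_def[abs_def] by (intro continuous_intros cont_Z cont_F)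
  have trG: "strip_trace (k * h) G"
    unfolding G_def[abs_def]
    by (intro strip_trace_mult trF strip_trace_Z sq cont_F cont_Z cont_ZZ)
  have intVG: "integrable circ (\<lambda>x. V1 x * G x)"
    by (intro integrable_mult_sq_integrable sqV1 sq cont_G)
  define R where "R x = p x - M" for x
  \<comment> \<open>The imaginary part of \<open>F * F'\<close> times the square of
    \<open>cnj W\<close>.\<close>
  define T where "T x = (R x * q1 x + q x * p1 x) * ((a x)\<^sup>2 - (b x)\<^sup>2)
      - 2 * a x * b x * (R x * p1 x - q x * q1 x)" for x
  have ImVG: "Im (V1 x * G x) = (P x)\<^sup>2 * T x" for x
  proof -
    have "F x = Complex (R x) (q x)" by (simp add: F_def R_def V complex_eq_iff)
    then show ?thesis
      by (simp add: G_def V1 Z_def W_def T_def power2_eq_square algebra_simps)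
  qed
  have intT: "integrable circ (\<lambda>x. (P x)\<^sup>2 * T x)" and zeroT: "(LINT x|circ. (P x)\<^sup>2 * T x) = 0"
    using strip_trace_integral_Im[OF strip_trace_mult[OF trV1 sqV1 trG sq[OF cont_G]] intVG]
      integrable_Im[OF intVG] by (simp_all only: ImVG)

  \<comment> \<open>As \<open>P = g * B / Y\<close>, this is \<open>g * B\<close> times the
    derivative of \<open>R * q / Y\<close>; in terms of \<open>P\<close> it needs only
    \<open>P' = - 2 * g * b\<close>.\<close>
  define N where "N x = (p1 x * q x + R x * q1 x) * P x + R x * q x * (- 2 * g * b x)" for x
  have acR: "ac_deriv_on 0 (2 * pi) R p1"
    using ac_deriv_on_add[OF acp ac_deriv_on_const[of 0 "2 * pi" "- M"]] by (simp add: R_def[abs_def])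
  have acP: "ac_deriv_on 0 (2 * pi) P (\<lambda>x. - 2 * g * b x)"
    by (intro ac_deriv_on_DERIV DERIV_P continuous_intros cont)
  have acN: "ac_deriv_on 0 (2 * pi) (\<lambda>x. R x * q x * P x) N"
    unfolding N_def[abs_def] by (intro ac_deriv_on_mult acR acq acP)
  have zeroN: "(LINT x|circ. N x) = 0"
    using ac_deriv_on_circ(2)[OF acN] p_per[of 0] q_per[of 0] P_per[of 0] by (simp add: R_def)

  define X1 where "X1 x = u x * (A1 x - \<Phi> x * u x)" for x
  define X2 where "X2 x = b x / Y x * (A1 x - \<Phi> x * u x)" for x
  define S where "S x = P x * q x * p1 x - g * (q x)\<^sup>2 * a x" for x
  have Y0: "Y x \<noteq> 0" for x using Y_pos[of x] by simp
  have L: "sq_integrable circ (\<lambda>x. A1 x - \<Phi> x * u x)"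
    using sq_integrable_diff[OF L2_perD(3)[OF A1L] sq_integrable_circ_continuous[OF continuous_on_mult[OF cont'(9) cont'(1)]]]
    by simp
  have cb: "sq_integrable circ (\<lambda>x. b x / Y x)"
    using Y0 by (intro sq_integrable_circ_continuous continuous_intros cont') auto
  have int1: "integrable circ X1" "integrable circ X2"
    unfolding X1_def[abs_def] X2_def[abs_def]
    by (rule integrable_mult_sq_integrable[OF sq_integrable_circ_continuous[OF cont'(1)] L]
        integrable_mult_sq_integrable[OF cb L])+
  have intS: "integrable circ S"
    unfolding S_def[abs_def]
    by (intro Bochner_Integration.integrable_diff integrable_mult_sq_integrable
        sq_integrable_circ_continuous L2_perD(3) p1L integrable_circ_continuous continuous_intros cont'
        continuous_on_subset[OF cont_q subset_UNIV])
  \<comment> \<open>The pointwise identity times \<open>g * B\<close>; because of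
    \<open>P = g * B / Y\<close> the factor \<open>g * B / (2 * Y^2)\<close> of \<open>T\<close> is
    \<open>P^2 / (2 * g * B)\<close>.\<close>
  have key: "g * B * X1 x + g * B * M * X2 x = S x + (P x)\<^sup>2 * T x / (2 * (g * B)) - N x / 2" for x
  proof -
    have B: "B \<noteq> 0" and gB: "g * B \<noteq> 0" using B_pos g by auto
    have P: "P x = g * B / Y x" using bernoulli[of x] Y0[of x] by (simp add: field_simps)
    note id = plotnikov_pointwise_identity[OF Y_def[of x] Y0 B a_a'[of x], of "u x" M "A1 x" "A x" "u1 x",
        folded p_def q_def p1_def q1_def \<Phi>_def R_def T_def]
    have "g * B * X1 x + g * B * M * X2 x = g * B * ((u x + M * b x / Y x) * (A1 x - \<Phi> x * u x))"
      by (simp add: X1_def X2_def algebra_simps)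
    also have "(u x + M * b x / Y x) * (A1 x - \<Phi> x * u x) = (q x * p1 x / Y x - (q x)\<^sup>2 * a x / B)
        + T x / (2 * (Y x)\<^sup>2) - ((p1 x * q x + R x * q1 x) / Y x - 2 * R x * q x * b x / B) / 2"
      using id unfolding T_def by linarith
    also have "g * B * \<dots> = S x + (P x)\<^sup>2 * T x / (2 * (g * B)) - N x / 2"
      unfolding S_def N_def P using B g Y0[of x] by (simp add: field_simps power2_eq_square)
    finally show ?thesis .
  qed
  have "g * B * (LINT x|circ. X1 x) + g * B * M * (LINT x|circ. X2 x)
      = (LINT x|circ. g * B * X1 x + g * B * M * X2 x)"
    using int1 by simp
  also have "\<dots> = (LINT x|circ. S x + (P x)\<^sup>2 * T x / (2 * (g * B)) - N x / 2)"
    by (simp only: key)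
  also have "\<dots> = (LINT x|circ. S x)"
    using intS intT zeroT ac_deriv_on_circ(1)[OF acN] zeroN by simp
  finally show ?thesis
    unfolding q second int2pi_circ using X1_def X2_def S_def by (simp add: algebra_simps)
qed

end

theorem proposition4p6:
  fixes g h k Q m \<alpha> :: real and w u :: "real \<Rightarrow> real"
  assumes "g > 0" and "h > 0" and "k > 0"
    and "0 < \<alpha>" and "\<alpha> < 1"
    and "regular_graph_solution \<alpha> g h k Q m w"
    and "u \<in> H1_per0"
  shows "second_variation g k Q m w h (plotnikov_transform h k w u) (plotnikov_transform h k w u) =
    2 * g * bernoulli_B g h k m *
      int2pi (\<lambda>x. u x * (conj_op (k * h) (weak_deriv u) x - plotnikov_potential g h k m w x * u x))
    + 2 * g * bernoulli_B g h k m * M_mean (k * h) u w *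
      int2pi (\<lambda>x. deriv w x / (cmod (W_fun h k w x))\<^sup>2 *
        (conj_op (k * h) (weak_deriv u) x - plotnikov_potential g h k m w x * u x))"
proof -
  interpret graph_solution g h k Q m \<alpha> w
    using assms by unfold_locales
  \<comment> \<open>\<open>M\<close> is still schematic here and is matched with
    \<open>M_mean (k * h) u w\<close>.\<close>
  show ?thesis
    using second_variation_plotnikov[OF \<open>u \<in> H1_per0\<close>]
    unfolding plotnikov_potential_eq W_fun_eq cmod_W B_def b_def .
qed

end
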